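(* Let $k\ge2$, $\mathcal{A}_k=\{1,\dots,k\}$, let $X$ be a two-sided Arnoux-Rauzy subshift over $\mathcal{A}_k$, and let $f:\mathcal{A}_k\to\mathbb{R}$ be non-constant. Then for a dense $G_\delta$-set of $x\in X$, we have $\sigma_{\mathrm{pp}}(H_x)=\emptyset$.
   Context: $\mathbb{N}=\{1,2,\dots\}$. For $x\in\mathcal{A}_k^{\mathbb{N}}$ or $\mathcal{A}_k^{\mathbb{Z}}$, $F_x(n)$ is the set of factors (contiguous subwords) of $x$ of length $n$, and $F_x=\bigcup_n F_x(n)$. A factor $u$ is right-special if there are letters $a\ne b$ with $ua,ub\in F_x$; left-special if there are $a\neq b$ with $au,bu\in F_x$. The sequence $x$ is an Arnoux-Rauzy (AR) sequence if (1) $x$ is uniformly recurrent (each factor occurs with bounded gaps), (2) $|F_x(n)|=(k-1)n+1$ for all $n\in\mathbb{N}$, and (3) for each $n$, $F_x(n)$ contains exactly one right-special factor and exactly one left-special factor. The associated two-sided AR subshift is $X=\{y\in\mathcal{A}_k^{\mathbb{Z}} : F_y(n)=F_x(n)\ \forall n\in\mathbb{N}\}$, with the topology induced by the product topology on $\mathcal{A}_k^{\mathbb{Z}}$ ($\mathcal{A}_k$ discrete). For $x\in X$, $H_x$ is the bounded self-adjoint operator on $\mathcal{H}=\ell^2(\mathbb{Z})$ given by $(H_x\phi)(n)=\phi(n+1)+\phi(n-1)+V_x(n)\phi(n)$ with $V_x(n)=f(x_n)$. For $\phi\in\mathcal{H}$, the spectral measure $\mu_\phi$ is defined by $\langle\phi,(H_x-z)^{-1}\phi\rangle=\int_{\mathbb{R}}\frac{d\mu_\phi(t)}{t-z}$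 for all $z$ with $\mathrm{Im}\,z>0$; $\mathcal{H}_{\mathrm{pp}}=\{\phi\in\mathcal{H}:\mu_\phi\text{ is pure point}\}$ and $\sigma_{\mathrm{pp}}(H_x)=\sigma(H_x|_{\mathcal{H}_{\mathrm{pp}}})$. *)

theory Defs
  imports "HOL-Analysis.Analysis"
begin

(* A one-sided sequence (I = {1..}) or a two-sided one (I = UNIV) is a function on int of
   which only the values on I are relevant. Both index sets are closed under successor. *)

definition word_at :: "(int \<Rightarrow> nat) \<Rightarrow> int \<Rightarrow> nat \<Rightarrow> nat list" where
  "word_at x i n = map (\<lambda>j. x (i + int j)) [0..<n]"

definition factors :: "int set \<Rightarrow> (int \<Rightarrow> nat) \<Rightarrow> nat \<Rightarrow> nat list set" where
  "factors I x n = {word_at x i n | i. i \<in> I}"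

definition language :: "int set \<Rightarrow> (int \<Rightarrow> nat) \<Rightarrow> nat list set" where
  "language I x = (\<Union>n\<in>{1..}. factors I x n)"

definition right_special :: "int set \<Rightarrow> (int \<Rightarrow> nat) \<Rightarrow> nat list \<Rightarrow> bool" where
  "right_special I x u \<longleftrightarrow>
     (\<exists>a b. a \<noteq> b \<and> u @ [a] \<in> language I x \<and> u @ [b] \<in> language I x)"

definition left_special :: "int set \<Rightarrow> (int \<Rightarrow> nat) \<Rightarrow> nat list \<Rightarrow> bool" where
  "left_special I x u \<longleftrightarrow>
     (\<exists>a b. a \<noteq> b \<and> a # u \<in> language I x \<and> b # u \<in> language I x)"

definition uniformly_recurrent :: "int set \<Rightarrow> (int \<Rightarrow> nat) \<Rightarrow> bool" where
  "uniformly_recurrent I x \<longleftrightarrow>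
     (\<forall>u\<in>language I x. \<exists>N. \<forall>i\<in>I. \<exists>j\<in>I. i \<le> j \<and> j \<le> i + int N \<and> word_at x j (length u) = u)"

definition arnoux_rauzy :: "nat \<Rightarrow> int set \<Rightarrow> (int \<Rightarrow> nat) \<Rightarrow> bool" where
  "arnoux_rauzy k I x \<longleftrightarrow>
     x ` I \<subseteq> {1..k} \<and>
     uniformly_recurrent I x \<and>
     (\<forall>n\<ge>1. card (factors I x n) = (k - 1) * n + 1) \<and>
     (\<forall>n\<ge>1. (\<exists>!u. u \<in> factors I x n \<and> right_special I x u) \<and>
             (\<exists>!u. u \<in> factors I x n \<and> left_special I x u))"

definition two_sided_subshift :: "nat \<Rightarrow> int set \<Rightarrow> (int \<Rightarrow> nat) \<Rightarrow> (int \<Rightarrow> nat) set" where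
  "two_sided_subshift k I x =
     {y. range y \<subseteq> {1..k} \<and> (\<forall>n\<ge>1. factors UNIV y n = factors I x n)}"

definition AR_subshift :: "nat \<Rightarrow> (int \<Rightarrow> nat) set \<Rightarrow> bool" where
  "AR_subshift k X \<longleftrightarrow>
     (\<exists>I x. I \<in> {{1..}, UNIV} \<and> arnoux_rauzy k I x \<and> X = two_sided_subshift k I x)"

definition subshift_topology :: "nat \<Rightarrow> (int \<Rightarrow> nat) set \<Rightarrow> (int \<Rightarrow> nat) topology" where
  "subshift_topology k X =
     subtopology (product_topology (\<lambda>_. discrete_topology {1..k}) UNIV) X"

definition l2 :: "(int \<Rightarrow> complex) set" where
  "l2 = {\<phi>. (\<lambda>n. (cmod (\<phi> n))\<^sup>2) summable_on UNIV}"

definition l2_inner :: "(int \<Rightarrow> complex) \<Rightarrow> (int \<Rightarrow> complex) \<Rightarrow> complex" where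
  "l2_inner \<phi> \<psi> = (\<Sum>\<^sub>\<infinity>n. cnj (\<phi> n) * \<psi> n)"

definition l2_norm :: "(int \<Rightarrow> complex) \<Rightarrow> real" where
  "l2_norm \<phi> = sqrt (\<Sum>\<^sub>\<infinity>n. (cmod (\<phi> n))\<^sup>2)"

definition schroedinger ::
    "(nat \<Rightarrow> real) \<Rightarrow> (int \<Rightarrow> nat) \<Rightarrow> (int \<Rightarrow> complex) \<Rightarrow> int \<Rightarrow> complex" where
  "schroedinger f x \<phi> n = \<phi> (n + 1) + \<phi> (n - 1) + of_real (f (x n)) * \<phi> n"

definition minus_scalar ::
    "((int \<Rightarrow> complex) \<Rightarrow> int \<Rightarrow> complex) \<Rightarrow> complex \<Rightarrow> (int \<Rightarrow> complex) \<Rightarrow> int \<Rightarrow> complex" where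
  "minus_scalar T z \<phi> n = T \<phi> n - z * \<phi> n"

definition resolvent ::
    "((int \<Rightarrow> complex) \<Rightarrow> int \<Rightarrow> complex) \<Rightarrow> complex \<Rightarrow> (int \<Rightarrow> complex) \<Rightarrow> int \<Rightarrow> complex" where
  "resolvent T z = inv_into l2 (minus_scalar T z)"

(* The restriction of T to M: z is in the resolvent set iff T - z is a bijection of M
   with bounded inverse. *)
definition spectrum_on ::
    "(int \<Rightarrow> complex) set \<Rightarrow> ((int \<Rightarrow> complex) \<Rightarrow> int \<Rightarrow> complex) \<Rightarrow> complex set" where
  "spectrum_on M T =
     {z. \<not> (bij_betw (minus_scalar T z) M M \<and>
            (\<exists>C. \<forall>\<phi>\<in>M. l2_norm \<phi> \<le> C * l2_norm (minus_scalar T z \<phi>)))}"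

definition is_spectral_measure ::
    "((int \<Rightarrow> complex) \<Rightarrow> int \<Rightarrow> complex) \<Rightarrow> (int \<Rightarrow> complex) \<Rightarrow> real measure \<Rightarrow> bool" where
  "is_spectral_measure T \<phi> \<mu> \<longleftrightarrow>
     sets \<mu> = sets borel \<and> finite_measure \<mu> \<and>
     (\<forall>z. Im z > 0 \<longrightarrow> l2_inner \<phi> (resolvent T z \<phi>) = (LINT t|\<mu>. 1 / (of_real t - z)))"

definition pure_point :: "real measure \<Rightarrow> bool" where
  "pure_point \<mu> \<longleftrightarrow> (\<exists>S. countable S \<and> emeasure \<mu> (UNIV - S) = 0)"

(* For a bounded self-adjoint T the spectral measure of a vector of l2 exists and is unique,
   so the existential quantifier just names it. *)
definition H_pp :: "((int \<Rightarrow> complex) \<Rightarrow> int \<Rightarrow> complex) \<Rightarrow> (int \<Rightarrow> complex) set" where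
  "H_pp T = {\<phi> \<in> l2. \<exists>\<mu>. is_spectral_measure T \<phi> \<mu> \<and> pure_point \<mu>}"

definition sigma_pp :: "((int \<Rightarrow> complex) \<Rightarrow> int \<Rightarrow> complex) \<Rightarrow> complex set" where
  "sigma_pp T = spectrum_on (H_pp T) T"

end

theory Submission
  imports Defs
begin

text \<open>
A potential that is symmetric on a huge interval about a far away centre leaves no room for
eigenfunctions; this is the method of Hof, Knill and Simon. Suppose that \<open>x\<close> is symmetric under
\<open>n \<mapsto> s - n\<close> on an interval of length \<open>L\<close> around the origin and that \<open>u\<close> is a square-summable
eigenfunction. The reflected sequence \<open>n \<mapsto> u (s - n)\<close> solves the same equation on that interval, so
the Wronskian of the two is constant there, and as its sum is at most a multiple of the square norm
of \<open>u\<close>, its size is at most a multiple of \<open>1 / L\<close>. At the centre \<open>s / 2\<close> the Wronskian factors, one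
factor measuring how far \<open>u\<close> is from its reflection and the other how far it is from the negative of
its reflection. One of the two is therefore small, and moving from the centre to the origin costs at
most a factor exponential in \<open>s\<close>. If \<open>L\<close> is much larger than that, \<open>u\<close> is at the origin almost as
small as near \<open>s\<close>. With such symmetries for arbitrarily large \<open>s\<close>, both initial values of \<open>u\<close> vanish
(\<open>no_eigenfunction_if_palindromic\<close>).

Such symmetries are generic in an Arnoux-Rauzy subshift because its language contains arbitrarily
long palindromes (\<open>long_palindromes\<close>). These are the bispecial factors: if every complete return to a
bispecial factor is a palindrome, then one of these returns is the next bispecial factor, and its own
complete returns, being symmetric concatenations of the old ones, are again palindromes
(\<open>next_bispecial\<close>). By uniform recurrence every finite pattern occurs slightly to the left of the
centre of an arbitrarily long palindrome, so the points having a symmetry of a given scale form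
a dense open set, and the Baire category theorem applies (\<open>generic_palindromic\<close>).

It remains to pass from eigenfunctions to spectral measures. If the spectral measure of \<open>\<phi>\<close> has an
atom at \<open>t\<close>, then the vectors \<open>\<epsilon> (H - t - i \<epsilon>)\<inverse> \<phi>\<close> are bounded in norm, and along a subsequence they
converge pointwise to a solution of \<open>H u = t u\<close> whose inner product with \<open>\<phi>\<close> is \<open>i\<close> times the mass of
the atom (\<open>atom_is_eigenvalue\<close>). Without eigenfunctions a pure point spectral measure is thus zero,
which forces \<open>\<phi> = 0\<close>. The pure point subspace is trivial, and an operator on the trivial space has
empty spectrum (\<open>sigma_pp_empty_if_no_eigenfunction\<close>).
\<close>

section \<open>Factors as agreement of positions\<close>

text \<open>
Equality of two factors of one sequence, in terms of their positions. Lengths are integers so that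
all position arithmetic stays in a single type; a negative length behaves like \<open>0\<close>.
\<close>
definition agree :: "(int \<Rightarrow> 'a) \<Rightarrow> int \<Rightarrow> int \<Rightarrow> int \<Rightarrow> bool" where
  "agree y i j n \<longleftrightarrow> (\<forall>t. 0 \<le> t \<and> t < n \<longrightarrow> y (i + t) = y (j + t))"

lemma agreeD: "agree y i j n \<Longrightarrow> 0 \<le> t \<Longrightarrow> t < n \<Longrightarrow> y (i + t) = y (j + t)"
  by (simp add: agree_def)

lemma agree_refl: "agree y i i n"
  by (simp add: agree_def)

lemma agree_sym: "agree y i j n \<Longrightarrow> agree y j i n"
  by (simp add: agree_def)

lemma agree_trans: "agree y i j n \<Longrightarrow> agree y j l n \<Longrightarrow> agree y i l n"
  by (simp add: agree_def)

lemma agree_mono: "agree y i j n \<Longrightarrow> m \<le> n \<Longrightarrow> agree y i j m"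
  by (simp add: agree_def)

lemma agree_shift:
  assumes "agree y i j n" "0 \<le> s" "s + m \<le> n"
  shows "agree y (i + s) (j + s) m"
  unfolding agree_def
proof (intro allI impI)
  fix t assume "0 \<le> t \<and> t < m"
  then show "y (i + s + t) = y (j + s + t)"
    using agreeD[OF assms(1), of "s + t"] assms by (simp add: add.assoc)
qed

lemma agree_snoc:
  assumes "agree y i j n" "y (i + n) = y (j + n)"
  shows "agree y i j (n + 1)"
  using assms unfolding agree_def by (metis zless_add1_eq)

lemma word_at_eq_iff:
  "word_at x i n = word_at x' j n \<longleftrightarrow> (\<forall>t. 0 \<le> t \<and> t < int n \<longrightarrow> x (i + t) = x' (j + t))"
proof -
  have "word_at x i n = word_at x' j n \<longleftrightarrow> (\<forall>t<n. x (i + int t) = x' (j + int t))"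
    by (auto simp: word_at_def)
  also have "\<dots> \<longleftrightarrow> (\<forall>t. 0 \<le> t \<and> t < int n \<longrightarrow> x (i + t) = x' (j + t))"
    by (metis int_nat_eq of_nat_0_le_iff of_nat_less_iff)
  finally show ?thesis .
qed

lemma word_at_agree: "word_at y i n = word_at y j n \<longleftrightarrow> agree y i j (int n)"
  by (simp add: word_at_eq_iff agree_def)

lemma word_at_Suc: "word_at y i (Suc n) = word_at y i n @ [y (i + int n)]"
  by (simp add: word_at_def)

lemma word_at_Suc': "word_at y i (Suc n) = y i # word_at y (i + 1) n"
  by (simp add: word_at_def upt_conv_Cons map_Suc_upt[symmetric] del: upt_Suc)
     (simp add: add.assoc)

lemma length_word_at [simp]: "length (word_at y i n) = n"
  by (simp add: word_at_def)

lemma word_at_in_factors: "word_at y i n \<in> factors UNIV y n"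
  by (auto simp: factors_def)

lemma word_at_in_language: "n \<ge> 1 \<Longrightarrow> word_at y i n \<in> language UNIV y"
  by (auto simp: language_def factors_def)

lemma language_UNIVD: "u \<in> language UNIV y \<Longrightarrow> \<exists>i. u = word_at y i (length u)"
  by (auto simp: language_def factors_def)

section \<open>Palindromes in Arnoux-Rauzy sequences\<close>

locale AR_word =
  fixes k :: nat and y :: "int \<Rightarrow> nat"
  assumes k2: "2 \<le> k" and AR: "arnoux_rauzy k UNIV y"
begin

lemma letters: "y i \<in> {1..k}"
  using AR unfolding arnoux_rauzy_def by blast

lemma card_factors: "n \<ge> 1 \<Longrightarrow> card (factors UNIV y n) = (k - 1) * n + 1"
  using AR by (auto simp: arnoux_rauzy_def)

text \<open>
Two positions that agree for \<open>n\<close> letters and then differ exhibit a right special factor, and there is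
only one of length \<open>n\<close>. This form also covers the empty factor.
\<close>
lemma right_special_unique:
  assumes "0 \<le> n" "agree y i j n" "y (i + n) \<noteq> y (j + n)"
    and "agree y i' j' n" "y (i' + n) \<noteq> y (j' + n)"
  shows "agree y i i' n"
proof (cases "n = 0")
  case False
  define m where "m = nat n"
  have m: "n = int m" "m \<ge> 1" using assms(1) False by (auto simp: m_def)
  have rs: "right_special UNIV y (word_at y a m)"
    if "agree y a b n" "y (a + n) \<noteq> y (b + n)" for a b
    unfolding right_special_def
    using that word_at_in_language[of "Suc m" y] word_at_Suc[of y]
    by (metis One_nat_def le_add1 m(1) plus_1_eq_Suc word_at_agree)
  have "\<exists>!u. u \<in> factors UNIV y m \<and> right_special UNIV y u"
    using AR m by (auto simp: arnoux_rauzy_def)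
  then have "word_at y i m = word_at y i' m"
    using rs assms word_at_in_factors by blast
  then show ?thesis by (simp add: word_at_agree m)
qed (simp add: agree_def)

lemma left_special_unique:
  assumes "0 \<le> n" "agree y i j n" "y (i - 1) \<noteq> y (j - 1)"
    and "agree y i' j' n" "y (i' - 1) \<noteq> y (j' - 1)"
  shows "agree y i i' n"
proof (cases "n = 0")
  case False
  define m where "m = nat n"
  have m: "n = int m" "m \<ge> 1" using assms(1) False by (auto simp: m_def)
  have ls: "left_special UNIV y (word_at y a m)"
    if "agree y a b n" "y (a - 1) \<noteq> y (b - 1)" for a b
    unfolding left_special_def
    using that word_at_in_language[of "Suc m" y] word_at_Suc'[of y "_ - 1"]
    by (metis One_nat_def diff_add_cancel le_add1 m(1) plus_1_eq_Suc word_at_agree)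
  have "\<exists>!u. u \<in> factors UNIV y m \<and> left_special UNIV y u"
    using AR m by (auto simp: arnoux_rauzy_def)
  then have "word_at y i m = word_at y i' m"
    using ls assms word_at_in_factors by blast
  then show ?thesis by (simp add: word_at_agree m)
qed (simp add: agree_def)

lemma left_special_exists:
  assumes "1 \<le> n"
  shows "\<exists>i j. agree y i j n \<and> y (i - 1) \<noteq> y (j - 1)"
proof -
  define m where "m = nat n"
  have m: "n = int m" "m \<ge> 1" using assms(1) by (auto simp: m_def)
  obtain u where u: "u \<in> factors UNIV y m" "left_special UNIV y u"
    using AR m by (auto simp: arnoux_rauzy_def)
  obtain a b where ab: "a \<noteq> b" "a # u \<in> language UNIV y" "b # u \<in> language UNIV y"
    using u by (auto simp: left_special_def)
  have len: "length u = m" using u(1) by (auto simp: factors_def)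
  obtain i j where "a # u = word_at y i (Suc m)" "b # u = word_at y j (Suc m)"
    using ab language_UNIVD len by (metis length_Cons)
  then have "a = y i" "b = y j" "word_at y (i + 1) m = word_at y (j + 1) m"
    by (simp_all add: word_at_Suc')
  then have "agree y (i + 1) (j + 1) n \<and> y (i + 1 - 1) \<noteq> y (j + 1 - 1)"
    using ab(1) by (simp add: word_at_agree m)
  then show ?thesis by blast
qed

text \<open>
The number of factors grows by \<open>k - 1\<close> from length \<open>n\<close> to length \<open>n + 1\<close>, and only the right special
factor has more than one extension; so it alone is responsible for the growth and extends by every
letter of the alphabet.
\<close>
lemma right_special_full:
  assumes "1 \<le> n"
  shows "\<exists>i. \<forall>d\<in>{1..k}. \<exists>j. agree y i j n \<and> y (j + n) = d"
proof -
  define m where "m = nat n"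
  have m: "n = int m" "m \<ge> 1" using assms(1) by (auto simp: m_def)
  let ?F = "factors UNIV y"
  define ext where "ext v = {d. v @ [d] \<in> ?F (Suc m)}" for v
  obtain u where u: "u \<in> ?F m" "right_special UNIV y u"
    and uniq: "\<And>v. v \<in> ?F m \<Longrightarrow> right_special UNIV y v \<Longrightarrow> v = u"
    using AR m unfolding arnoux_rauzy_def by metis
  have ext_sub: "ext v \<subseteq> {1..k}" for v
    using letters by (auto simp: ext_def factors_def word_at_Suc)
  have fin: "finite (?F m)"
    using card_factors[OF m(2)] by (metis add_is_0 card.infinite one_neq_zero)
  have "(\<lambda>(v, d). v @ [d]) ` Sigma (?F m) ext = ?F (Suc m)"
    by (force simp: ext_def factors_def word_at_Suc image_iff)
  moreover have "inj_on (\<lambda>(v, d). v @ [d]) (Sigma (?F m) ext)"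
    by (auto simp: inj_on_def)
  ultimately have "card (?F (Suc m)) = card (Sigma (?F m) ext)"
    using card_image by fastforce
  also have "\<dots> = (\<Sum>v\<in>?F m. card (ext v))"
    using fin ext_sub by (intro card_SigmaI) (auto intro: finite_subset)
  also have "\<dots> = card (ext u) + (\<Sum>v\<in>?F m - {u}. card (ext v))"
    using fin u by (simp add: sum.remove)
  also have "\<dots> \<le> card (ext u) + (\<Sum>v\<in>?F m - {u}. 1)"
  proof (intro add_left_mono sum_mono)
    fix v assume v: "v \<in> ?F m - {u}"
    have "\<not> right_special UNIV y v" using uniq v by blast
    then have "\<forall>a\<in>ext v. \<forall>b\<in>ext v. a = b"
      unfolding right_special_def ext_def language_def by fastforce
    then show "card (ext v) \<le> 1"
      using finite_subset[OF ext_sub] by (auto simp: card_le_Suc0_iff_eq)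
  qed
  also have "(\<Sum>v\<in>?F m - {u}. 1) = (k - 1) * m"
    using card_factors[OF m(2)] u fin by simp
  finally have "k \<le> card (ext u)"
    using card_factors[of "Suc m"] by simp
  then have "ext u = {1..k}"
    using ext_sub[of u] by (metis card_atLeastAtMost card_seteq diff_Suc_1 finite_atLeastAtMost)
  moreover obtain i where i: "u = word_at y i m"
    using u(1) by (auto simp: factors_def)
  ultimately have "\<forall>d\<in>{1..k}. \<exists>j. word_at y i m = word_at y j m \<and> y (j + n) = d"
    by (auto simp: ext_def factors_def word_at_Suc m set_eq_iff) metis
  then show ?thesis by (auto simp: word_at_agree m)
qed

lemma recurrent:
  assumes "0 \<le> n"
  shows "\<exists>N\<ge>0. \<forall>i. \<exists>j. i \<le> j \<and> j \<le> i + N \<and> agree y p j n"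
proof (cases "n = 0")
  case True
  then show ?thesis by (intro exI[of _ 0]) (auto simp: agree_def)
next
  case False
  define m where "m = nat n"
  have m: "n = int m" "m \<ge> 1" using assms(1) False by (auto simp: m_def)
  have "uniformly_recurrent UNIV y" using AR by (simp add: arnoux_rauzy_def)
  then obtain N where "\<forall>i. \<exists>j. i \<le> j \<and> j \<le> i + int N \<and> word_at y j m = word_at y p m"
    using word_at_in_language[OF m(2), of y p]
    by (auto simp: uniformly_recurrent_def dest!: bspec)
  then have "\<forall>i. \<exists>j. i \<le> j \<and> j \<le> i + int N \<and> agree y p j n"
    by (metis agree_sym m(1) word_at_agree)
  then show ?thesis by (intro exI[of _ "int N"]) simp
qed

text \<open>
The block from \<open>i\<close> to \<open>j + n\<close>, end excluded, is a complete return to the factor of length \<open>n\<close> at \<open>p\<close>;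
the two occurrences of the factor may overlap.
\<close>
definition next_occ :: "int \<Rightarrow> int \<Rightarrow> int \<Rightarrow> int \<Rightarrow> bool" where
  "next_occ p n i j \<longleftrightarrow> i < j \<and> agree y p i n \<and> agree y p j n \<and> (\<forall>m. i < m \<and> m < j \<longrightarrow> \<not> agree y p m n)"

lemma next_occ_exists:
  assumes "0 \<le> n" "agree y p i n"
  shows "\<exists>j. next_occ p n i j"
proof -
  obtain j0 where j0: "i + 1 \<le> j0" "agree y p j0 n" using recurrent[OF assms(1), of p] by blast
  define d where "d = (LEAST d. agree y p (i + 1 + int d) n)"
  have ex: "agree y p (i + 1 + int (nat (j0 - i - 1))) n" using j0 by simp
  have "agree y p (i + 1 + int d) n" unfolding d_def using LeastI[where P = "\<lambda>d. agree y p (i + 1 + int d) n", OF ex] .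
  moreover have "\<not> agree y p m n" if "i < m" "m < i + 1 + int d" for m
    using not_less_Least[of "nat (m - i - 1)" "\<lambda>d. agree y p (i + 1 + int d) n"] that
    by (auto simp: d_def[symmetric])
  ultimately have "next_occ p n i (i + 1 + int d)"
    using assms(2) by (auto simp: next_occ_def)
  then show ?thesis ..
qed

text \<open>
The sequence is two-sided, so recurrence can be used backwards in time as well.
\<close>
lemma prev_occ_exists:
  assumes "0 \<le> n" "agree y p j n"
  shows "\<exists>i. next_occ p n i j"
proof -
  obtain N where "\<forall>i. \<exists>j. i \<le> j \<and> j \<le> i + N \<and> agree y p j n"
    using recurrent[OF assms(1), of p] by blast
  then obtain j0 where j0: "j0 \<le> j - 1" "agree y p j0 n"
    by (metis diff_add_cancel add_diff_cancel_right')
  define d where "d = (LEAST d. agree y p (j - 1 - int d) n)"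
  have ex: "agree y p (j - 1 - int (nat (j - 1 - j0))) n" using j0 by simp
  have "agree y p (j - 1 - int d) n" unfolding d_def using LeastI[where P = "\<lambda>d. agree y p (j - 1 - int d) n", OF ex] .
  moreover have "\<not> agree y p m n" if "m < j" "m > j - 1 - int d" for m
    using not_less_Least[of "nat (j - 1 - m)" "\<lambda>d. agree y p (j - 1 - int d) n"] that
    by (auto simp: d_def[symmetric])
  ultimately have "next_occ p n (j - 1 - int d) j"
    using assms(2) by (auto simp: next_occ_def)
  then show ?thesis ..
qed

text \<open>
The invariant of the construction. It implies that the factor itself is a palindrome, since the factor
is both the prefix and the suffix of each of its complete returns.
\<close>
definition palindromic_returns :: "int \<Rightarrow> int \<Rightarrow> bool" where
  "palindromic_returns p n \<longleftrightarrow>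
     (\<forall>i j t. next_occ p n i j \<and> 0 \<le> t \<and> t < j - i + n \<longrightarrow> y (i + t) = y (j + n - 1 - t))"

definition bispecial :: "int \<Rightarrow> int \<Rightarrow> bool" where
  "bispecial p n \<longleftrightarrow>
     (\<exists>i j. agree y p i n \<and> agree y p j n \<and> y (i - 1) \<noteq> y (j - 1)) \<and>
     (\<exists>i j. agree y p i n \<and> agree y p j n \<and> y (i + n) \<noteq> y (j + n))"

text \<open>
The empty factor starts the construction: it has complete returns of length one only.
\<close>
lemma bispecial_empty: "bispecial p 0"
proof -
  obtain i where i: "\<forall>d\<in>{1..k}. \<exists>j. agree y i j 1 \<and> y (j + 1) = d"
    using right_special_full[of 1] by auto
  have "1 \<in> {1..k}" "2 \<in> {1..k}" using k2 by auto
  then obtain a b where "y (a + 1) = 1" "y (b + 1) = 2" using i by blast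
  then have "y (a + 2 - 1) \<noteq> y (b + 2 - 1)" "y (a + 1 + 0) \<noteq> y (b + 1 + 0)"
    by (simp_all add: add.commute)
  then show ?thesis unfolding bispecial_def agree_def by (meson not_le)
qed

lemma palindromic_returns_empty: "palindromic_returns p 0"
proof -
  have "j = i + 1" if "next_occ p 0 i j" for i j
  proof (rule ccontr)
    assume "j \<noteq> i + 1"
    then have "\<not> agree y p (i + 1) 0" using that by (auto simp: next_occ_def)
    then show False by (simp add: agree_def)
  qed
  then have "t = 0 \<and> j = i + 1" if "next_occ p 0 i j" "0 \<le> t" "t < j - i + 0" for i j t
    using that by force
  then show ?thesis unfolding palindromic_returns_def by fastforce
qed

lemma palindrome_of_returns:
  assumes "0 \<le> n" "palindromic_returns p n" "0 \<le> t" "t < n"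
  shows "y (p + t) = y (p + n - 1 - t)"
proof -
  obtain j where j: "next_occ p n p j" using next_occ_exists[OF assms(1)] agree_refl by blast
  then have "p < j" "agree y p j n" by (auto simp: next_occ_def)
  then have "y (p + (n - 1 - t)) = y (j + (n - 1 - t))"
    using assms by (intro agreeD) auto
  moreover have "y (p + t) = y (j + n - 1 - t)"
    using assms j \<open>p < j\<close> unfolding palindromic_returns_def by (metis add_0 add_strict_mono diff_gt_0_iff_gt)
  ultimately show ?thesis by (simp add: algebra_simps)
qed

text \<open>
Let \<open>w\<close> be the given bispecial factor. Exactly one letter \<open>a\<close> makes \<open>w a\<close> left special, and exactly one
letter \<open>b\<close> makes \<open>b w\<close> right special. If \<open>a\<close> and \<open>b\<close> were different, an occurrence of \<open>w\<close> followed by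
\<open>a\<close> would be followed by \<open>a\<close> at all later occurrences, against recurrence. Hence \<open>a = b\<close>, and of two
letters surrounding an occurrence of \<open>w\<close> at least one is \<open>a\<close>. The complete return to \<open>w\<close> that begins
with \<open>w a\<close> is unique, and it is the next bispecial factor. Between two consecutive occurrences of it
there is at most one further return to \<open>w\<close>, so its complete returns are
symmetric arrangements of palindromes.
\<close>
lemma next_bispecial:
  assumes n: "0 \<le> n" and bs: "bispecial p n" and pr: "palindromic_returns p n"
  shows "\<exists>q m. n < m \<and> bispecial q m \<and> palindromic_returns q m"
proof -
  define Oc where "Oc i = agree y p i n" for i
  have agr: "agree y i j n" if "Oc i" "Oc j" for i j
    using that agree_sym agree_trans unfolding Oc_def by metis
  obtain li lj ri rj where l: "Oc li" "Oc lj" "y (li - 1) \<noteq> y (lj - 1)"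
    and r: "Oc ri" "Oc rj" "y (ri + n) \<noteq> y (rj + n)"
    using bs unfolding bispecial_def Oc_def by blast
  have right_occ: "Oc i" if "agree y i j n" "y (i + n) \<noteq> y (j + n)" for i j
    using right_special_unique[OF n agr[OF r(1,2)] r(3) that] r(1) agree_trans unfolding Oc_def by blast
  have left_occ: "Oc i" if "agree y i j n" "y (i - 1) \<noteq> y (j - 1)" for i j
    using left_special_unique[OF n agr[OF l(1,2)] l(3) that] l(1) agree_trans unfolding Oc_def by blast
  have Oc_agree: "Oc j" if "Oc i" "agree y i j n" for i j
    using that agree_trans unfolding Oc_def by blast
  obtain i1 j1 where ij1: "agree y i1 j1 (n + 1)" "y (i1 - 1) \<noteq> y (j1 - 1)"
    using left_special_exists[of "n + 1"] n by auto
  have Oi1: "Oc i1" using left_occ[OF agree_mono[OF ij1(1)] ij1(2)] by simp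
  define a where "a = y (i1 + n)"
  obtain i2 where i2: "\<And>d. d \<in> {1..k} \<Longrightarrow> \<exists>j. agree y i2 j (n + 1) \<and> y (j + (n + 1)) = d"
    using right_special_full[of "n + 1"] n by (meson add_increasing2 le_numeral_extra(4) zero_le_one add_increasing)
  define b where "b = y i2"
  have ext_b: "\<exists>q. Oc q \<and> y (q - 1) = b \<and> y (q + n) = d" if d: "d \<in> {1..k}" for d
  proof -
    obtain d' where d': "d' \<in> {1..k}" "d' \<noteq> d"
      using k2 by (metis One_nat_def Suc_1 Suc_le_mono atLeastAtMost_iff le_SucI le_numeral_extra(4) nat.distinct(1) nat.inject order_trans)
    obtain j j' where j: "agree y i2 j (n + 1)" "y (j + (n + 1)) = d"
      "agree y i2 j' (n + 1)" "y (j' + (n + 1)) = d'" using i2 d d' by meson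
    have "agree y (j + 1) (j' + 1) n"
      using agree_shift[OF agree_trans[OF agree_sym[OF j(1)] j(3)], of 1 n] by simp
    moreover have "y (j + 1 + n) \<noteq> y (j' + 1 + n)" using j d' by (simp add: add.commute add.left_commute)
    ultimately have "Oc (j + 1)" by (rule right_occ)
    moreover have "y j = b" using agreeD[OF j(1), of 0] n by (simp add: b_def)
    moreover have "y (j + 1 + n) = d" using j by (simp add: add.commute add.left_commute)
    ultimately show ?thesis by (intro exI[of _ "j + 1"]) simp
  qed
  \<comment> \<open>By uniqueness of \<open>w a\<close>, every other right extension of \<open>w\<close> has a single left extension; it is
    \<open>b\<close>, because \<open>b w\<close> extends by all letters.\<close>
  have one_left: "y (q - 1) = b" if q: "Oc q" "y (q + n) \<noteq> a" for q
  proof (rule ccontr)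
    assume ne: "y (q - 1) \<noteq> b"
    obtain q' where q': "Oc q'" "y (q' - 1) = b" "y (q' + n) = y (q + n)"
      using ext_b letters by blast
    have "agree y i1 q (n + 1)"
      using left_special_unique[OF _ ij1, of q q'] agree_snoc[OF agr[OF q(1) q'(1)]] q' ne n by simp
    then show False using agreeD[of y i1 q "n + 1" n] n q by (simp add: a_def)
  qed
  \<comment> \<open>The return from \<open>i\<close> to \<open>j\<close> is a palindrome: the letter after its prefix \<open>w\<close> equals the letter
    before its suffix \<open>w\<close>.\<close>
  have next_letter: "y (j - 1) = y (i + n)" if "next_occ p n i j" for i j
  proof -
    have "y (i + n) = y (j + n - 1 - n)"
      using that pr n unfolding palindromic_returns_def next_occ_def by (metis diff_gt_0_iff_gt less_add_same_cancel2)
    then show ?thesis by simp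
  qed
  have "a = b"
  proof (rule ccontr)
    assume ab: "a \<noteq> b"
    have *: "Oc q \<longrightarrow> q = i1 + int m \<longrightarrow> y (q + n) = a" for m q
    proof (induction m arbitrary: q rule: less_induct)
      case (less m)
      show ?case
      proof (intro impI)
        assume q: "Oc q" "q = i1 + int m"
        show "y (q + n) = a"
        proof (cases "m = 0")
          case False
          obtain q' where q': "next_occ p n q' q" using prev_occ_exists[OF n] q by (auto simp: Oc_def)
          have "\<not> q' < i1" using q' Oi1 q False unfolding next_occ_def Oc_def by auto
          then have "y (q' + n) = a"
            using q' less[of "nat (q' - i1)" q'] q unfolding next_occ_def Oc_def by auto
          then show ?thesis using next_letter[OF q'] one_left[OF q(1)] ab by auto
        qed (simp add: q a_def)
      qed
    qed
    obtain d where d: "d \<in> {1..k}" "d \<noteq> a"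
      using k2 by (metis One_nat_def Suc_1 Suc_le_mono atLeastAtMost_iff le_SucI le_numeral_extra(4) nat.distinct(1) nat.inject order_trans)
    obtain q0 where q0: "Oc q0" "y (q0 + n) = d" using ext_b[OF d(1)] by blast
    obtain q where q: "i1 \<le> q" "agree y q0 q (n + 1)"
      using recurrent[of "n + 1" q0] n by auto
    have "Oc q" using Oc_agree[OF q0(1) agree_mono[OF q(2)]] by simp
    moreover have "y (q + n) = d" using agreeD[OF q(2), of n] n q0 by simp
    ultimately show False using *[of q "nat (q - i1)"] q d by simp
  qed
  then have no_two: "y (q - 1) = a \<or> y (q + n) = a" if "Oc q" for q
    using one_left[OF that] by auto
  obtain j0 where j0: "next_occ p n i1 j0" using next_occ_exists[OF n] Oi1 by (auto simp: Oc_def)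
  define l where "l = j0 - i1"
  have l0: "0 < l" using j0 by (simp add: l_def next_occ_def)
  \<comment> \<open>A first difference between two returns beginning with \<open>w a\<close> would follow a right special
    factor, hence an occurrence of \<open>w\<close> inside one of the returns.\<close>
  have return: "r - q = l \<and> agree y i1 q (n + l)" if q: "y (q + n) = a" "next_occ p n q r" for q r
  proof -
    define M where "M = min l (r - q)"
    have Oq: "Oc q" and qr: "q < r" and Or: "Oc r" using q(2) by (auto simp: next_occ_def Oc_def)
    have M0: "0 < M" using l0 qr by (simp add: M_def)
    have *: "int s \<le> M - 1 \<longrightarrow> agree y i1 q (n + 1 + int s)" for s
    proof (induction s)
      case 0
      show ?case using agree_snoc[OF agr[OF Oi1 Oq]] q(1) by (simp add: a_def)
    next
      case (Suc s)
      show ?case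
      proof
        assume s: "int (Suc s) \<le> M - 1"
        then have ag: "agree y i1 q (n + 1 + int s)" using Suc by simp
        have "y (i1 + (n + 1 + int s)) = y (q + (n + 1 + int s))"
        proof (rule ccontr)
          assume ne: "\<not> ?thesis"
          have "Oc (i1 + (1 + int s))"
            using right_occ[OF agree_shift[OF ag, of "1 + int s" n]] ne by (simp add: algebra_simps)
          then show False using j0 s unfolding next_occ_def Oc_def M_def l_def by auto
        qed
        from agree_snoc[OF ag this] show "agree y i1 q (n + 1 + int (Suc s))"
          by (simp add: algebra_simps)
      qed
    qed
    have ag: "agree y i1 q (n + M)" using *[of "nat (M - 1)"] M0 by (simp add: algebra_simps)
    have sh: "agree y (i1 + M) (q + M) n" using agree_shift[OF ag, of M n] M0 by simp
    have "l = r - q"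
    proof (rule ccontr)
      assume "l \<noteq> r - q"
      then consider "l < r - q" | "r - q < l" by linarith
      then show False
      proof cases
        case 1
        then have "Oc (q + l)"
          using Oc_agree[of j0] sh j0 unfolding next_occ_def Oc_def[symmetric] M_def l_def by simp
        then show False using q(2) 1 l0 unfolding next_occ_def Oc_def by auto
      next
        case 2
        then have "Oc (i1 + (r - q))"
          using Oc_agree[OF Or] agree_sym[OF sh] unfolding M_def by simp
        then show False using j0 2 qr unfolding next_occ_def Oc_def l_def by auto
      qed
    qed
    then show ?thesis using ag by (simp add: M_def)
  qed
  define m where "m = n + l"
  have occ_iff: "agree y i1 q m \<longleftrightarrow> Oc q \<and> y (q + n) = a" for q
  proof
    assume ag: "agree y i1 q m"
    show "Oc q \<and> y (q + n) = a"
      using Oc_agree[OF Oi1 agree_mono[OF ag]] agreeD[OF ag, of n] l0 n by (simp add: m_def a_def)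
  next
    assume q: "Oc q \<and> y (q + n) = a"
    then obtain r where "next_occ p n q r" using next_occ_exists[OF n] by (auto simp: Oc_def)
    then show "agree y i1 q m" using return q by (auto simp: m_def)
  qed
  have "bispecial i1 m"
    unfolding bispecial_def
  proof (intro conjI)
    have "agree y i1 j1 m"
      using occ_iff Oc_agree[OF Oi1 agree_mono[OF ij1(1)]] agreeD[OF ij1(1), of n] n by (simp add: a_def)
    then show "\<exists>i j. agree y i1 i m \<and> agree y i1 j m \<and> y (i - 1) \<noteq> y (j - 1)"
      using ij1(2) agree_refl by blast
    have "\<exists>q. agree y i1 q m \<and> y (q + m) = d" if d: "d \<in> {1..k}" for d
    proof -
      obtain q where q: "Oc q" "y (q - 1) = a" "y (q + n) = d"
        using ext_b[OF d] \<open>a = b\<close> by blast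
      obtain q' where q': "next_occ p n q' q" using prev_occ_exists[OF n] q by (auto simp: Oc_def)
      then have "y (q' + n) = a" using next_letter q by simp
      then have "agree y i1 q' m" "q - q' = l" using return q' by (auto simp: m_def)
      moreover from this have "q' + m = q + n" by (simp add: m_def)
      ultimately show ?thesis using q by auto
    qed
    from this[of 1] this[of 2] show "\<exists>i j. agree y i1 i m \<and> agree y i1 j m \<and> y (i + m) \<noteq> y (j + m)"
      using k2 by (metis One_nat_def Suc_1 atLeastAtMost_iff le_SucI le_numeral_extra(4) n_not_Suc_n order_trans)
  qed
  moreover have "palindromic_returns i1 m"
    unfolding palindromic_returns_def
  proof (intro allI impI)
    fix i j t assume H: "next_occ i1 m i j \<and> 0 \<le> t \<and> t < j - i + m"
    then have ij: "i < j" "Oc i" "y (i + n) = a" "Oc j" "y (j + n) = a" and agi: "agree y i1 i m" "agree y i1 j m"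
      and none: "\<And>q. i < q \<Longrightarrow> q < j \<Longrightarrow> Oc q \<Longrightarrow> y (q + n) \<noteq> a"
      using occ_iff by (auto simp: next_occ_def)
    have agij: "agree y i j m" using agi agree_sym agree_trans by blast
    obtain i' where i': "next_occ p n i i'" using next_occ_exists[OF n] ij by (auto simp: Oc_def)
    obtain j' where j': "next_occ p n j j'" using next_occ_exists[OF n] ij by (auto simp: Oc_def)
    have il: "i' = i + l" and jl: "j' = j + l" using return i' j' ij by force+
    have pal_i: "y (i + s) = y (i + (m - 1 - s))" if "0 \<le> s" "s < m" for s
    proof -
      have "y (i + s) = y (i' + n - 1 - s)"
        using pr i' that il unfolding palindromic_returns_def by (simp add: m_def)
      then show ?thesis by (simp add: il m_def algebra_simps)
    qed
    have pal_j: "y (j + s) = y (j + (m - 1 - s))" if "0 \<le> s" "s < m" for s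
    proof -
      have "y (j + s) = y (j' + n - 1 - s)"
        using pr j' that jl unfolding palindromic_returns_def by (simp add: m_def)
      then show ?thesis by (simp add: jl m_def algebra_simps)
    qed
    have le: "i' \<le> j" using i' ij unfolding next_occ_def Oc_def by force
    \<comment> \<open>The letter after the occurrence at \<open>i'\<close> is not \<open>a\<close>, so the letter after the next one is.\<close>
    have nx: "next_occ p n i' j" if "i' \<noteq> j"
    proof -
      have lt: "i' < j" using le that by simp
      have Oi': "Oc i'" using i' by (simp add: next_occ_def Oc_def)
      have na: "y (i' + n) \<noteq> a" using none lt Oi' il l0 by simp
      obtain r where r: "next_occ p n i' r" using next_occ_exists[OF n] Oi' by (auto simp: Oc_def)
      have Or: "Oc r" "i' < r" using r by (auto simp: next_occ_def Oc_def)
      have "y (r + n) = a" using no_two[OF Or(1)] next_letter[OF r] na by simp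
      then have "\<not> r < j" using none[of r] Or il l0 by auto
      moreover have "\<not> j < r" using r lt ij unfolding next_occ_def Oc_def by auto
      ultimately show ?thesis using r by simp
    qed
    \<comment> \<open>The outer two blocks are copies of the same palindrome of length \<open>m\<close>; what lies strictly
      between them is inside the middle return.\<close>
    consider "t < m" | "t \<ge> j - i" | "m \<le> t" "t < j - i" by linarith
    then show "y (i + t) = y (j + m - 1 - t)"
    proof cases
      case 1
      then have "y (i + t) = y (i + (m - 1 - t))" using pal_i H by blast
      also have "\<dots> = y (j + (m - 1 - t))" using agreeD[OF agij] 1 H by simp
      finally show ?thesis by (simp add: algebra_simps)
    next
      case 2
      define s where "s = t - (j - i)"
      have s: "0 \<le> s" "s < m" using 2 H by (auto simp: s_def)
      have "y (i + t) = y (j + s)" by (simp add: s_def add.commute)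
      also have "\<dots> = y (j + (m - 1 - s))" using pal_j s by blast
      also have "\<dots> = y (i + (m - 1 - s))" using agreeD[OF agij, of "m - 1 - s"] s by simp
      also have "i + (m - 1 - s) = j + m - 1 - t" by (simp add: s_def)
      finally show ?thesis .
    next
      case 3
      then have "i' \<noteq> j" using il n by (auto simp: m_def)
      moreover have "0 \<le> t - l" "t - l < j - i' + n" using 3 n il by (auto simp: m_def)
      ultimately have "y (i' + (t - l)) = y (j + n - 1 - (t - l))"
        using pr nx unfolding palindromic_returns_def by blast
      then show ?thesis by (simp add: il m_def algebra_simps)
    qed
  qed
  ultimately show ?thesis using l0 by (intro exI[of _ i1] exI[of _ m]) (simp add: m_def)
qed

lemma long_palindromes:
  "\<exists>c n. N \<le> n \<and> (\<forall>t. 0 \<le> t \<and> t < n \<longrightarrow> y (c + t) = y (c + n - 1 - t))"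
proof -
  have "\<exists>p n. int M \<le> n \<and> bispecial p n \<and> palindromic_returns p n" for M
  proof (induction M)
    case 0
    show ?case using bispecial_empty palindromic_returns_empty by (intro exI[of _ 0]) auto
  next
    case (Suc M)
    then obtain p n where pn: "int M \<le> n" "bispecial p n" "palindromic_returns p n" by blast
    then obtain q m where "n < m" "bispecial q m" "palindromic_returns q m"
      using next_bispecial[of n p] by force
    then show ?case using pn(1) by (intro exI[of _ q] exI[of _ m]) auto
  qed
  from this[of "nat N"] obtain p n where "int (nat N) \<le> n" "palindromic_returns p n" by blast
  then have "N \<le> n" "0 \<le> n" "\<forall>t. 0 \<le> t \<and> t < n \<longrightarrow> y (p + t) = y (p + n - 1 - t)"
    using palindrome_of_returns[of n p] by (auto split: if_splits)
  then show ?thesis by blast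
qed

end

section \<open>Palindromes are generic in the subshift\<close>

abbreviation window :: "nat \<Rightarrow> int set" where
  "window N \<equiv> {- int N..int N}"

lemma finite_subset_window: "finite F \<Longrightarrow> \<exists>N. F \<subseteq> window N"
proof (induction F rule: finite_induct)
  case (insert a F)
  then obtain N where "F \<subseteq> window N" by blast
  then have "insert a F \<subseteq> window (max N (nat \<bar>a\<bar>))" by (auto simp: subset_iff)
  then show ?case by blast
qed simp

lemma filterlim_window: "filterlim window (finite_subsets_at_top UNIV) sequentially"
  unfolding filterlim_finite_subsets_at_top
proof (intro allI impI)
  fix F :: "int set" assume "finite F \<and> F \<subseteq> UNIV"
  then obtain N where "F \<subseteq> window N" using finite_subset_window by blast
  then have "F \<subseteq> window n" if "N \<le> n" for n using that by (auto simp: subset_iff)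
  then show "\<forall>\<^sub>F n in sequentially. finite (window n) \<and> F \<subseteq> window n \<and> window n \<subseteq> UNIV"
    by (auto simp: eventually_sequentially)
qed

text \<open>
The centre \<open>s / 2\<close> of the reflection may be an integer or a half-integer, according to the parity of
the length of the underlying palindrome. The interval is centred at the origin, not at \<open>s / 2\<close>.
\<close>
definition reflection_symmetric :: "(int \<Rightarrow> 'a) \<Rightarrow> nat \<Rightarrow> nat \<Rightarrow> bool" where
  "reflection_symmetric x s L \<longleftrightarrow> (\<forall>n. \<bar>n\<bar> \<le> int L \<longrightarrow> x (int s - n) = x n)"

text \<open>
Propagating a solution from the centre \<open>s / 2\<close> to the origin costs a factor \<open>B ^ (s + 2)\<close> in the square,
with \<open>B\<close> depending on the energy. The radius \<open>(N + 1) ^ (s + 3)\<close> exceeds this by a factor \<open>N + 1\<close> as soon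
as \<open>B \<le> N + 1\<close>, so one condition serves all energies.
\<close>
definition palindromic_at_scale :: "nat \<Rightarrow> (int \<Rightarrow> 'a) \<Rightarrow> bool" where
  "palindromic_at_scale N x \<longleftrightarrow> (\<exists>s\<ge>N. reflection_symmetric x s ((N + 1) ^ (s + 3)))"

text \<open>
A point of the subshift has the same language as the sequence that generates it, so it is itself
a two-sided Arnoux-Rauzy sequence with the same subshift. In particular a one-sided generator can be
replaced by a two-sided one. Recurrence carries over because any long enough window of \<open>y\<close> is
a window of \<open>x\<close>.
\<close>
lemma AR_subshift_two_sided:
  assumes k: "2 \<le> k" and X: "AR_subshift k X" and y: "y \<in> X"
  shows "AR_word k y" and "X = two_sided_subshift k UNIV y"
proof -
  obtain I x where I: "I \<in> {{1..}, UNIV}" and x: "arnoux_rauzy k I x" and Xd: "X = two_sided_subshift k I x"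
    using X by (auto simp: AR_subshift_def)
  have range: "range y \<subseteq> {1..k}" and fac: "\<And>n. n \<ge> 1 \<Longrightarrow> factors UNIV y n = factors I x n"
    using y by (auto simp: Xd two_sided_subshift_def)
  have lang: "language UNIV y = language I x" using fac by (auto simp: language_def)
  have "uniformly_recurrent UNIV y"
    unfolding uniformly_recurrent_def
  proof
    fix w assume w: "w \<in> language UNIV y"
    obtain N where N: "\<And>i. i \<in> I \<Longrightarrow> \<exists>j\<in>I. i \<le> j \<and> j \<le> i + int N \<and> word_at x j (length w) = w"
      using x w lang unfolding arnoux_rauzy_def uniformly_recurrent_def by metis
    have "\<exists>j\<in>UNIV. i \<le> j \<and> j \<le> i + int N \<and> word_at y j (length w) = w" for i
    proof -
      have "word_at y i (N + length w + 1) \<in> factors I x (N + length w + 1)"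
        using fac[of "N + length w + 1"] word_at_in_factors[of y i "N + length w + 1"] by simp
      then obtain i' where i': "i' \<in> I" "word_at y i (N + length w + 1) = word_at x i' (N + length w + 1)"
        by (auto simp: factors_def)
      obtain j where j: "i' \<le> j" "j \<le> i' + int N" "word_at x j (length w) = w" using N[OF i'(1)] by blast
      have "word_at y (i + (j - i')) (length w) = word_at x j (length w)"
        unfolding word_at_eq_iff
      proof (intro allI impI)
        fix t assume "0 \<le> t \<and> t < int (length w)"
        then have "y (i + (j - i' + t)) = x (i' + (j - i' + t))"
          using i'(2) j unfolding word_at_eq_iff by auto
        then show "y (i + (j - i') + t) = x (j + t)" by (simp add: algebra_simps)
      qed
      then show ?thesis using j by (intro bexI[of _ "i + (j - i')"]) auto
    qed
    then show "\<exists>N. \<forall>i\<in>UNIV. \<exists>j\<in>UNIV. i \<le> j \<and> j \<le> i + int N \<and> word_at y j (length w) = w" by blast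
  qed
  moreover have "right_special UNIV y = right_special I x" "left_special UNIV y = left_special I x"
    by (simp_all add: right_special_def left_special_def lang fun_eq_iff)
  ultimately have "arnoux_rauzy k UNIV y"
    using x range fac unfolding arnoux_rauzy_def by simp
  then show "AR_word k y" using k by unfold_locales
  show "X = two_sided_subshift k UNIV y"
    using fac by (simp add: Xd two_sided_subshift_def)
qed

abbreviation full_shift :: "nat \<Rightarrow> (int \<Rightarrow> nat) topology" where
  "full_shift k \<equiv> product_topology (\<lambda>_. discrete_topology {1..k}) UNIV"

lemma topspace_full_shift: "z \<in> topspace (full_shift k) \<longleftrightarrow> range z \<subseteq> {1..k}"
  by (simp add: PiE_iff image_subset_iff)

lemma openin_cylinder:
  assumes "finite F"
  shows "openin (full_shift k) {z' \<in> topspace (full_shift k). \<forall>n\<in>F. z' n = z n}"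
proof -
  let ?S = "\<lambda>n. if n \<in> F then {z n} \<inter> {1..k} else {1..k}"
  have "{z' \<in> topspace (full_shift k). \<forall>n\<in>F. z' n = z n} = PiE UNIV ?S"
    by (auto simp: PiE_iff split: if_splits)
  moreover have "finite {n \<in> UNIV. ?S n \<noteq> topspace (discrete_topology {1..k})}"
    using assms by (rule rev_finite_subset) auto
  ultimately show ?thesis
    by (simp add: openin_PiE_gen)
qed

lemma cylinder_in_open:
  assumes "openin (full_shift k) U" "z \<in> U"
  shows "\<exists>R. \<forall>z'\<in>topspace (full_shift k). (\<forall>n\<in>window R. z' n = z n) \<longrightarrow> z' \<in> U"
proof -
  obtain S where fin: "finite {n \<in> UNIV. S n \<noteq> topspace (discrete_topology {1..k})}"
    and z: "z \<in> PiE UNIV S" and sub: "PiE UNIV S \<subseteq> U"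
    using assms unfolding openin_product_topology_alt by blast
  obtain R where R: "{n \<in> UNIV. S n \<noteq> topspace (discrete_topology {1..k})} \<subseteq> window R"
    using finite_subset_window[OF fin] by blast
  have "z' \<in> U" if z': "z' \<in> topspace (full_shift k)" and ag: "\<forall>n\<in>window R. z' n = z n" for z'
  proof -
    have "z' n \<in> S n" for n
    proof (cases "n \<in> window R")
      case True
      then show ?thesis using ag z by (auto simp: PiE_iff)
    next
      case False
      then have "S n = {1..k}" using R by auto
      then show ?thesis using z' by (auto simp: PiE_iff)
    qed
    then show ?thesis using sub by (auto simp: PiE_iff)
  qed
  then show ?thesis by blast
qed

context AR_word
begin

abbreviation "subshift \<equiv> two_sided_subshift k UNIV y"

text \<open>
It suffices that every window of \<open>z\<close> occurs in \<open>y\<close>: by uniform recurrence a long window of \<open>y\<close>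
contains all shorter factors, so \<open>z\<close> misses none of them. The right-hand side is a closed condition.
\<close>
lemma in_subshift_iff:
  "z \<in> subshift \<longleftrightarrow> (\<forall>i n. \<exists>j. \<forall>t. 0 \<le> t \<and> t < int n \<longrightarrow> z (i + t) = y (j + t))"
proof
  assume z: "z \<in> subshift"
  show "\<forall>i n. \<exists>j. \<forall>t. 0 \<le> t \<and> t < int n \<longrightarrow> z (i + t) = y (j + t)"
  proof (intro allI)
    fix i n
    show "\<exists>j. \<forall>t. 0 \<le> t \<and> t < int n \<longrightarrow> z (i + t) = y (j + t)"
    proof (cases "n = 0")
      case False
      then have "word_at z i n \<in> factors UNIV y n"
        using z word_at_in_factors[of z i n] by (auto simp: two_sided_subshift_def)
      then show ?thesis unfolding factors_def mem_Collect_eq word_at_eq_iff by auto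
    qed simp
  qed
next
  assume R: "\<forall>i n. \<exists>j. \<forall>t. 0 \<le> t \<and> t < int n \<longrightarrow> z (i + t) = y (j + t)"
  have "z i \<in> {1..k}" for i
  proof -
    obtain j where "\<forall>t. 0 \<le> t \<and> t < int 1 \<longrightarrow> z (i + t) = y (j + t)" using R by blast
    then have "z (i + 0) = y (j + 0)" by (metis less_numeral_extra(1) of_nat_1 order_refl)
    then show ?thesis using letters[of j] by simp
  qed
  then have "range z \<subseteq> {1..k}" by blast
  moreover have "factors UNIV z n = factors UNIV y n" if "1 \<le> n" for n
  proof
    show "factors UNIV z n \<subseteq> factors UNIV y n"
    proof
      fix w assume "w \<in> factors UNIV z n"
      then obtain i where i: "w = word_at z i n" by (auto simp: factors_def)
      obtain j where "\<forall>t. 0 \<le> t \<and> t < int n \<longrightarrow> z (i + t) = y (j + t)" using R by blast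
      then have "w = word_at y j n" unfolding i word_at_eq_iff .
      then show "w \<in> factors UNIV y n" using word_at_in_factors by simp
    qed
    show "factors UNIV y n \<subseteq> factors UNIV z n"
    proof
      fix w assume "w \<in> factors UNIV y n"
      then obtain p where p: "w = word_at y p n" by (auto simp: factors_def)
      obtain N where N: "0 \<le> N" "\<And>i. \<exists>j. i \<le> j \<and> j \<le> i + N \<and> agree y p j (int n)"
        using recurrent[of "int n" p] by auto
      obtain j where j: "\<And>t. 0 \<le> t \<Longrightarrow> t < int (nat N + n) \<Longrightarrow> z (0 + t) = y (j + t)"
        using R by blast
      obtain q where q: "j \<le> q" "q \<le> j + N" "agree y p q (int n)" using N by blast
      have "word_at z (q - j) n = word_at y q n"
        unfolding word_at_eq_iff
      proof (intro allI impI)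
        fix t assume "0 \<le> t \<and> t < int n"
        then have "z (0 + (q - j + t)) = y (j + (q - j + t))" using q N(1) by (intro j) auto
        then show "z (q - j + t) = y (q + t)" by simp
      qed
      also have "\<dots> = w" using q p by (simp add: word_at_agree agree_sym)
      finally show "w \<in> factors UNIV z n" using word_at_in_factors[of z "q - j" n] by simp
    qed
  qed
  ultimately show "z \<in> subshift" by (simp add: two_sided_subshift_def)
qed

lemma subshift_subset: "subshift \<subseteq> topspace (full_shift k)"
  using topspace_full_shift by (auto simp: two_sided_subshift_def simp del: topspace_product_topology)

lemma topspace_subshift: "topspace (subshift_topology k subshift) = subshift"
  unfolding subshift_topology_def topspace_subtopology using subshift_subset by blast

lemma closedin_subshift: "closedin (full_shift k) subshift"
  unfolding closedin_def
proof (intro conjI)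
  show "openin (full_shift k) (topspace (full_shift k) - subshift)"
  proof (subst openin_subopen, intro ballI)
    fix z assume z: "z \<in> topspace (full_shift k) - subshift"
    then have "z \<notin> subshift" by blast
    then obtain i n where none: "\<And>j. \<exists>t. 0 \<le> t \<and> t < int n \<and> z (i + t) \<noteq> y (j + t)"
      unfolding in_subshift_iff by blast
    let ?C = "{z' \<in> topspace (full_shift k). \<forall>m\<in>{i..i + int n}. z' m = z m}"
    have "?C \<inter> subshift = {}"
    proof (intro equals0I)
      fix z' assume z': "z' \<in> ?C \<inter> subshift"
      then have "z' \<in> subshift" by blast
      then obtain j where j: "\<And>t. 0 \<le> t \<Longrightarrow> t < int n \<Longrightarrow> z' (i + t) = y (j + t)"
        unfolding in_subshift_iff by blast
      obtain t where "0 \<le> t" "t < int n" "z (i + t) \<noteq> y (j + t)" using none by blast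
      moreover have "z' (i + t) = z (i + t)" using z' \<open>0 \<le> t\<close> \<open>t < int n\<close> by auto
      ultimately show False using j by simp
    qed
    then have "openin (full_shift k) ?C \<and> z \<in> ?C \<and> ?C \<subseteq> topspace (full_shift k) - subshift"
      using z openin_cylinder[of "{i..i + int n}" k z] by blast
    then show "\<exists>T. openin (full_shift k) T \<and> z \<in> T \<and> T \<subseteq> topspace (full_shift k) - subshift" by blast
  qed
qed (rule subshift_subset)

lemma Baire_subshift: "locally_compact_space (subshift_topology k subshift) \<and> regular_space (subshift_topology k subshift)"
proof -
  have "compact_space (full_shift k)"
    by (simp add: compact_space_product_topology compact_space_discrete_topology)
  then have "compactin (full_shift k) subshift" using closedin_subshift closedin_compact_space by blast
  then have "compact_space (subshift_topology k subshift)"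
    by (simp add: subshift_topology_def compact_space_subtopology)
  moreover have "Hausdorff_space (subshift_topology k subshift)"
    unfolding subshift_topology_def
    by (intro Hausdorff_space_subtopology) (simp add: Hausdorff_space_product_topology)
  ultimately show ?thesis
    by (simp add: compact_imp_locally_compact_space compact_Hausdorff_imp_regular_space)
qed

lemma openin_palindromic:
  "openin (subshift_topology k subshift) {z \<in> subshift. palindromic_at_scale N z}"
  unfolding subshift_topology_def
proof (subst openin_subopen, intro ballI)
  fix z assume z: "z \<in> {z \<in> subshift. palindromic_at_scale N z}"
  then obtain s where s: "N \<le> s" "reflection_symmetric z s ((N + 1) ^ (s + 3))"
    by (auto simp: palindromic_at_scale_def)
  define L where "L = (N + 1) ^ (s + 3)"
  let ?C = "{z' \<in> topspace (full_shift k). \<forall>m\<in>window (s + L). z' m = z m}"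
  have "palindromic_at_scale N z'" if z': "z' \<in> ?C" for z'
  proof -
    have "z' (int s - n) = z' n" if n: "\<bar>n\<bar> \<le> int L" for n
    proof -
      have "n \<in> window (s + L)" "int s - n \<in> window (s + L)" using n by auto
      then have "z' n = z n" "z' (int s - n) = z (int s - n)" using z' by blast+
      then show ?thesis using s n by (simp add: reflection_symmetric_def L_def)
    qed
    then show ?thesis using s by (auto simp: palindromic_at_scale_def reflection_symmetric_def L_def)
  qed
  moreover have "openin (subtopology (full_shift k) subshift) (subshift \<inter> ?C)"
    by (intro openin_subtopology_Int2 openin_cylinder) simp
  moreover have "z \<in> subshift \<inter> ?C" using z subshift_subset by blast
  ultimately show "\<exists>T. openin (subtopology (full_shift k) subshift) T \<and> z \<in> T \<and> T \<subseteq> {z \<in> subshift. palindromic_at_scale N z}"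
    by (intro exI[of _ "subshift \<inter> ?C"]) blast
qed

text \<open>
Take a palindrome of \<open>y\<close> that is long compared to the radius \<open>L\<close> and to the recurrence gap \<open>g\<close> of the
pattern \<open>z\<close> on the window. The pattern occurs, centred at some \<open>p\<close>, within distance \<open>g\<close> to the left of
the point lying about \<open>N / 2\<close> before the centre of the palindrome. The shift of \<open>y\<close> by \<open>p\<close> then has its
centre of symmetry between \<open>N / 2\<close> and \<open>S / 2\<close>, where \<open>S\<close> is known before the palindrome is chosen.
\<close>
lemma palindromic_near:
  assumes z: "z \<in> subshift"
  shows "\<exists>z'\<in>subshift. palindromic_at_scale N z' \<and> (\<forall>n\<in>window R. z' n = z n)"
proof -
  obtain c0 where c0: "\<And>t. 0 \<le> t \<Longrightarrow> t < int (2 * R + 1) \<Longrightarrow> z (- int R + t) = y (c0 + t)"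
    using z unfolding in_subshift_iff by blast
  obtain g where g: "0 \<le> g" "\<And>i. \<exists>j. i \<le> j \<and> j \<le> i + g \<and> agree y c0 j (int (2 * R + 1))"
    using recurrent[of "int (2 * R + 1)" c0] by auto
  define S where "S = N + 2 + 2 * nat g"
  define L where "L = int ((N + 1) ^ (S + 3))"
  have L: "0 \<le> L" by (simp add: L_def)
  obtain c n where n: "2 * L + 2 * g + int N + 4 \<le> n"
    and pal: "\<And>t. 0 \<le> t \<Longrightarrow> t < n \<Longrightarrow> y (c + t) = y (c + n - 1 - t)"
    using long_palindromes[of "2 * L + 2 * g + int N + 4"] by blast
  define p0 where "p0 = c + (n - 1 - int N) div 2 - g"
  obtain q where q: "p0 - int R \<le> q" "q \<le> p0 - int R + g" "agree y c0 q (int (2 * R + 1))"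
    using g(2)[of "p0 - int R"] by blast
  define p where "p = q + int R"
  have p: "p0 \<le> p" "p \<le> p0 + g" using q by (auto simp: p_def)
  define s where "s = nat (2 * c + n - 1 - 2 * p)"
  have h: "2 * ((n - 1 - int N) div 2) \<le> n - 1 - int N" "n - 1 - int N - 1 \<le> 2 * ((n - 1 - int N) div 2)"
    by linarith+
  have s_ge: "int N \<le> 2 * c + n - 1 - 2 * p" and s_le: "2 * c + n - 1 - 2 * p \<le> int N + 2 + 2 * g"
    using p h unfolding p0_def by linarith+
  have s: "int s = 2 * c + n - 1 - 2 * p" "N \<le> s" "s \<le> S"
    using s_ge s_le g(1) by (auto simp: s_def S_def)
  define z' where "z' m = y (p + m)" for m
  have "z' \<in> subshift"
    unfolding in_subshift_iff z'_def by (metis add.assoc)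
  moreover have "palindromic_at_scale N z'"
  proof -
    have "z' (int s - m) = z' m" if m: "\<bar>m\<bar> \<le> int ((N + 1) ^ (s + 3))" for m
    proof -
      have "(N + 1) ^ (s + 3) \<le> (N + 1) ^ (S + 3)" using s by (intro power_increasing) auto
      then have mL: "\<bar>m\<bar> \<le> L" using m unfolding L_def by linarith
      have "y (c + (p + m - c)) = y (c + n - 1 - (p + m - c))"
        using mL n p h g L unfolding p0_def by (intro pal) linarith+
      then show ?thesis by (simp add: z'_def s(1) algebra_simps)
    qed
    then show ?thesis using s(2) by (auto simp: palindromic_at_scale_def reflection_symmetric_def)
  qed
  moreover have "z' m = z m" if m: "m \<in> window R" for m
  proof -
    have "z (- int R + (m + int R)) = y (c0 + (m + int R))" using m by (intro c0) auto
    also have "\<dots> = y (q + (m + int R))" using m by (intro agreeD[OF q(3)]) auto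
    finally show ?thesis by (simp add: z'_def p_def algebra_simps)
  qed
  ultimately show ?thesis by blast
qed

lemma dense_palindromic:
  "subshift_topology k subshift closure_of {z \<in> subshift. palindromic_at_scale N z} = topspace (subshift_topology k subshift)"
proof -
  have "\<exists>z'. z' \<in> {z \<in> subshift. palindromic_at_scale N z} \<and> z' \<in> T"
    if z: "z \<in> subshift" and T: "z \<in> T" "openin (subshift_topology k subshift) T" for z T
  proof -
    obtain U where U: "openin (full_shift k) U" "T = U \<inter> subshift"
      using T(2) by (auto simp: subshift_topology_def openin_subtopology)
    obtain R where "\<And>z'. z' \<in> topspace (full_shift k) \<Longrightarrow> \<forall>n\<in>window R. z' n = z n \<Longrightarrow> z' \<in> U"
      using cylinder_in_open[OF U(1)] T(1) U(2) by blast
    then show ?thesis using palindromic_near[OF z, of N R] U(2) subshift_subset by blast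
  qed
  then show ?thesis unfolding closure_of_def topspace_subshift by blast
qed

text \<open>
The subshift is compact and Hausdorff, so Baire's theorem holds in it.
\<close>
lemma generic_palindromic:
  fixes G defines "G \<equiv> {z \<in> subshift. \<forall>N. palindromic_at_scale N z}"
  shows "gdelta_in (subshift_topology k subshift) G" and "subshift_topology k subshift closure_of G = subshift"
proof -
  let ?\<O> = "range (\<lambda>N. {z \<in> subshift. palindromic_at_scale N z})"
  have G: "G = \<Inter> ?\<O>" by (auto simp: G_def)
  show "gdelta_in (subshift_topology k subshift) G"
    unfolding G by (intro gdelta_in_Inter) (auto intro: open_imp_gdelta_in openin_palindromic)
  have "subshift_topology k subshift closure_of \<Inter> ?\<O> = topspace (subshift_topology k subshift)"
    using Baire_subshift openin_palindromic dense_palindromic by (intro Baire_category) auto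
  then show "subshift_topology k subshift closure_of G = subshift" by (simp add: G topspace_subshift)
qed

end

section \<open>Square-summable sequences\<close>

lemma l2I:
  assumes "\<And>N. (\<Sum>n\<in>window N. (cmod (\<psi> n))\<^sup>2) \<le> C"
  shows "\<psi> \<in> l2"
proof -
  have "(\<Sum>n\<in>F. (cmod (\<psi> n))\<^sup>2) \<le> C" if F: "finite F" for F
  proof -
    obtain N where "F \<subseteq> window N" using finite_subset_window F by blast
    then have "(\<Sum>n\<in>F. (cmod (\<psi> n))\<^sup>2) \<le> (\<Sum>n\<in>window N. (cmod (\<psi> n))\<^sup>2)" by (intro sum_mono2) auto
    then show ?thesis using assms[of N] by simp
  qed
  then show ?thesis unfolding l2_def mem_Collect_eq
    by (intro nonneg_bounded_partial_sums_imp_summable_on[where C = C])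
       (auto simp: eventually_finite_subsets_at_top)
qed

lemma l2_sum_le:
  assumes "\<psi> \<in> l2" "finite F"
  shows "(\<Sum>n\<in>F. (cmod (\<psi> n))\<^sup>2) \<le> (l2_norm \<psi>)\<^sup>2"
proof -
  have "(l2_norm \<psi>)\<^sup>2 = (\<Sum>\<^sub>\<infinity>n. (cmod (\<psi> n))\<^sup>2)"
    unfolding l2_norm_def by (simp add: infsum_nonneg)
  then show ?thesis using assms by (simp add: l2_def finite_sum_le_infsum)
qed

lemma l2_tendsto_zero:
  assumes "\<psi> \<in> l2" "inj (e :: nat \<Rightarrow> int)"
  shows "(\<lambda>j. \<psi> (e j)) \<longlonglongrightarrow> 0"
proof -
  have "(\<lambda>n. (cmod (\<psi> n))\<^sup>2) summable_on range e"
    using assms(1) by (auto simp: l2_def intro: summable_on_subset)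
  then have "((\<lambda>n. (cmod (\<psi> n))\<^sup>2) \<circ> e) summable_on UNIV"
    using summable_on_reindex[OF assms(2)] by blast
  then have "(\<lambda>j. (cmod (\<psi> (e j)))\<^sup>2) \<longlonglongrightarrow> 0"
    unfolding o_def by (intro summable_LIMSEQ_zero summable_on_imp_summable)
  then have "(\<lambda>j. sqrt ((cmod (\<psi> (e j)))\<^sup>2)) \<longlonglongrightarrow> sqrt 0"
    by (intro tendsto_intros)
  then show ?thesis by (simp add: tendsto_norm_zero_iff)
qed

lemma weighted_AM_GM:
  fixes a b d :: real
  assumes "0 < d"
  shows "a * b \<le> (a\<^sup>2 / d + d * b\<^sup>2) / 2"
proof -
  have "0 \<le> (a - d * b)\<^sup>2 / d" using assms by simp
  also have "\<dots> = a\<^sup>2 / d + d * b\<^sup>2 - 2 * (a * b)"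
    using assms by (simp add: power2_diff field_simps power2_eq_square)
  finally show ?thesis by simp
qed

lemma l2_inner_summable:
  assumes "\<phi> \<in> l2" "\<psi> \<in> l2"
  shows "(\<lambda>n. cmod (cnj (\<phi> n) * \<psi> n)) summable_on UNIV"
proof (rule summable_on_comparison_test)
  have "(\<lambda>n. (cmod (\<phi> n))\<^sup>2 + (cmod (\<psi> n))\<^sup>2) summable_on UNIV"
    using assms by (intro summable_on_add) (auto simp: l2_def)
  then show "(\<lambda>n. ((cmod (\<phi> n))\<^sup>2 + (cmod (\<psi> n))\<^sup>2) * (1 / 2)) summable_on UNIV"
    by (rule summable_on_cmult_left)
  show "cmod (cnj (\<phi> n) * \<psi> n) \<le> ((cmod (\<phi> n))\<^sup>2 + (cmod (\<psi> n))\<^sup>2) * (1 / 2)" for n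
    using weighted_AM_GM[of 1 "cmod (\<phi> n)" "cmod (\<psi> n)"] by (simp add: norm_mult)
qed auto

lemma l2_inner_window:
  assumes "\<phi> \<in> l2" "\<psi> \<in> l2"
  shows "(\<lambda>N. \<Sum>n\<in>window N. cnj (\<phi> n) * \<psi> n) \<longlonglongrightarrow> l2_inner \<phi> \<psi>"
proof -
  have "(\<lambda>n. cnj (\<phi> n) * \<psi> n) summable_on UNIV"
    using l2_inner_summable[OF assms] by (rule abs_summable_summable)
  then have "((\<lambda>n. cnj (\<phi> n) * \<psi> n) has_sum l2_inner \<phi> \<psi>) UNIV"
    unfolding l2_inner_def by (rule has_sum_infsum)
  then show ?thesis
    unfolding has_sum_def by (rule filterlim_compose[OF _ filterlim_window])
qed

text \<open>
Outside a finite set \<open>F\<close> the sequence \<open>\<phi>\<close> has small mass, and the weighted inequality between the means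
absorbs the bounded mass of \<open>\<psi> j\<close>; on \<open>F\<close> pointwise convergence suffices.
\<close>
lemma l2_inner_weak_limit:
  assumes \<phi>: "\<phi> \<in> l2" and \<psi>: "\<And>j. \<psi> j \<in> l2" "\<And>j. (l2_norm (\<psi> j))\<^sup>2 \<le> C"
    and lim: "\<And>n. (\<lambda>j. \<psi> j n) \<longlonglongrightarrow> 0"
  shows "(\<lambda>j. l2_inner \<phi> (\<psi> j)) \<longlonglongrightarrow> 0"
proof (rule LIMSEQ_I)
  fix e :: real assume e: "0 < e"
  have C0: "0 \<le> C" using \<psi>(2)[of 0] by (meson order_trans zero_le_power2)
  define d where "d = e / (2 * (C + 1))"
  have d: "0 < d" using e C0 by (simp add: d_def)
  have dC: "d * C \<le> e / 2"
    using C0 e by (simp add: d_def field_simps)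
  have sm: "(\<lambda>n. (cmod (\<phi> n))\<^sup>2) summable_on UNIV" using \<phi> by (simp add: l2_def)
  obtain F where F: "finite F" "dist (\<Sum>n\<in>F. (cmod (\<phi> n))\<^sup>2) (\<Sum>\<^sub>\<infinity>n. (cmod (\<phi> n))\<^sup>2) \<le> e * d / 2"
    using infsum_finite_approximation[OF sm, of "e * d / 2"] e d by auto
  have tail: "(\<Sum>n\<in>G. (cmod (\<phi> n))\<^sup>2) \<le> e * d / 2" if G: "finite G" "G \<inter> F = {}" for G
  proof -
    have "(\<Sum>n\<in>G \<union> F. (cmod (\<phi> n))\<^sup>2) \<le> (\<Sum>\<^sub>\<infinity>n. (cmod (\<phi> n))\<^sup>2)"
      using sm F G by (intro finite_sum_le_infsum) auto
    moreover have "(\<Sum>n\<in>G \<union> F. (cmod (\<phi> n))\<^sup>2) = (\<Sum>n\<in>G. (cmod (\<phi> n))\<^sup>2) + (\<Sum>n\<in>F. (cmod (\<phi> n))\<^sup>2)"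
      using F G by (intro sum.union_disjoint)
    ultimately show ?thesis using F(2) unfolding dist_real_def by linarith
  qed
  have "(\<lambda>j. \<Sum>n\<in>F. cmod (\<phi> n) * cmod (\<psi> j n)) \<longlonglongrightarrow> (\<Sum>n\<in>F. cmod (\<phi> n) * cmod 0)"
    by (intro tendsto_sum tendsto_mult tendsto_const tendsto_norm lim)
  then have "\<forall>\<^sub>F j in sequentially. (\<Sum>n\<in>F. cmod (\<phi> n) * cmod (\<psi> j n)) < e / 2"
    using e by (intro order_tendstoD(2)) auto
  then obtain j0 where j0: "\<And>j. j0 \<le> j \<Longrightarrow> (\<Sum>n\<in>F. cmod (\<phi> n) * cmod (\<psi> j n)) < e / 2"
    by (auto simp: eventually_sequentially)
  have "norm (l2_inner \<phi> (\<psi> j) - 0) < e" if j: "j0 \<le> j" for j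
  proof -
    let ?s = "\<Sum>n\<in>F. cmod (\<phi> n) * cmod (\<psi> j n)"
    have fin: "(\<Sum>n\<in>G. cmod (cnj (\<phi> n) * \<psi> j n)) \<le> ?s + e / 2" if G: "finite G" for G
    proof -
      have "(\<Sum>n\<in>G. cmod (cnj (\<phi> n) * \<psi> j n)) =
          (\<Sum>n\<in>G \<inter> F. cmod (\<phi> n) * cmod (\<psi> j n)) + (\<Sum>n\<in>G - F. cmod (\<phi> n) * cmod (\<psi> j n))"
        using G by (simp add: norm_mult sum.Int_Diff[of G _ F])
      also have "(\<Sum>n\<in>G \<inter> F. cmod (\<phi> n) * cmod (\<psi> j n)) \<le> ?s"
        using F by (intro sum_mono2) auto
      also have "(\<Sum>n\<in>G - F. cmod (\<phi> n) * cmod (\<psi> j n))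
          \<le> (\<Sum>n\<in>G - F. ((cmod (\<phi> n))\<^sup>2 / d + d * (cmod (\<psi> j n))\<^sup>2) / 2)"
        using d by (intro sum_mono weighted_AM_GM)
      also have "\<dots> = ((\<Sum>n\<in>G - F. (cmod (\<phi> n))\<^sup>2) / d + d * (\<Sum>n\<in>G - F. (cmod (\<psi> j n))\<^sup>2)) / 2"
        by (simp add: sum.distrib sum_divide_distrib[symmetric] sum_distrib_left[symmetric])
      also have "\<dots> \<le> ((e * d / 2) / d + d * C) / 2"
      proof -
        have "(\<Sum>n\<in>G - F. (cmod (\<psi> j n))\<^sup>2) \<le> C"
          using l2_sum_le[OF \<psi>(1), of "G - F" j] \<psi>(2)[of j] G by (simp add: order_trans)
        then show ?thesis using tail[of "G - F"] G d
          by (intro divide_right_mono add_mono mult_left_mono) (auto simp: disjoint_iff)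
      qed
      also have "\<dots> \<le> e / 2" using d dC e by simp
      finally show ?thesis by simp
    qed
    have "norm (l2_inner \<phi> (\<psi> j)) \<le> (\<Sum>\<^sub>\<infinity>n. cmod (cnj (\<phi> n) * \<psi> j n))"
      unfolding l2_inner_def using l2_inner_summable[OF \<phi> \<psi>(1)] by (rule norm_infsum_bound)
    also have "\<dots> \<le> ?s + e / 2"
      using l2_inner_summable[OF \<phi> \<psi>(1)] fin by (intro infsum_le_finite_sums) auto
    also have "\<dots> < e" using j0[OF j] by simp
    finally show ?thesis by simp
  qed
  then show "\<exists>no. \<forall>n\<ge>no. norm (l2_inner \<phi> (\<psi> n) - 0) < e" by blast
qed

text \<open>
Tychonoff's theorem for a countable product of closed discs, which is metrizable.
\<close>
lemma bounded_pointwise_subsequence: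
  fixes g :: "nat \<Rightarrow> int \<Rightarrow> complex"
  assumes "\<And>j n. cmod (g j n) \<le> C"
  shows "\<exists>r l. strict_mono r \<and> (\<forall>n. (\<lambda>j. g (r j) n) \<longlonglongrightarrow> l n)"
proof -
  let ?K = "Pi\<^sub>E UNIV (\<lambda>n :: int. cball (0 :: complex) C)"
  have "compactin (product_topology (\<lambda>n :: int. euclidean) UNIV) ?K"
    by (simp add: compactin_PiE)
  then have "compact ?K" by (simp add: euclidean_product_topology)
  moreover have "\<forall>j. g j \<in> ?K" using assms by auto
  ultimately obtain l r where "strict_mono r" "(g \<circ> r) \<longlonglongrightarrow> l"
    by (metis compact_imp_seq_compact seq_compactE)
  then have "(\<lambda>j. g (r j) n) \<longlonglongrightarrow> l n" for n
    using continuous_on_tendsto_compose[OF continuous_on_product_coordinates[of n], of "g \<circ> r" l sequentially]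
    by (simp add: o_def)
  then show ?thesis using \<open>strict_mono r\<close> by blast
qed

section \<open>The resolvent\<close>

text \<open>
The imaginary part of \<open>\<langle>\<psi>, (H - z) \<psi>\<rangle>\<close>, one site at a time: as \<open>H\<close> is symmetric, it contributes only
differences of the current \<open>Im (cnj (\<psi> n) * \<psi> (n + 1))\<close>, which telescope.
\<close>
lemma energy_identity_site:
  "Im (cnj (\<psi> n) * minus_scalar (schroedinger f x) z \<psi> n) =
     Im (cnj (\<psi> n) * \<psi> (n + 1)) - Im (cnj (\<psi> (n - 1)) * \<psi> n) - Im z * (cmod (\<psi> n))\<^sup>2"
proof -
  have "(cmod (\<psi> n))\<^sup>2 = Re (\<psi> n) * Re (\<psi> n) + Im (\<psi> n) * Im (\<psi> n)"
    by (metis cmod_power2 power2_eq_square)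
  then show ?thesis by (simp add: minus_scalar_def schroedinger_def algebra_simps)
qed

lemma sum_window_telescope:
  fixes A :: "int \<Rightarrow> real"
  shows "(\<Sum>n\<in>window N. A n - A (n - 1)) = A (int N) - A (- int N - 1)"
proof (induction N)
  case (Suc N)
  have "window (Suc N) = insert (int N + 1) (insert (- int N - 1) (window N))" by auto
  then show ?case using Suc by (simp add: algebra_simps)
qed simp

lemma energy_identity:
  "Im z * (\<Sum>n\<in>window N. (cmod (\<psi> n))\<^sup>2) =
     Im (cnj (\<psi> (int N)) * \<psi> (int N + 1)) - Im (cnj (\<psi> (- int N - 1)) * \<psi> (- int N))
     - (\<Sum>n\<in>window N. Im (cnj (\<psi> n) * minus_scalar (schroedinger f x) z \<psi> n))"
  using sum_window_telescope[of "\<lambda>n. Im (cnj (\<psi> n) * \<psi> (n + 1))" N]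
  unfolding energy_identity_site by (simp add: sum_subtractf sum_distrib_left)

text \<open>
This is the bound \<open>\<parallel>(H - z)\<inverse>\<parallel> \<le> 1 / Im z\<close> with its boundary terms on a finite window. They vanish in
two cases of interest: for Dirichlet conditions, and in the limit for square-summable \<open>\<psi>\<close>.
\<close>
lemma energy_bound:
  assumes z: "0 < Im z"
    and \<phi>: "\<And>n. n \<in> window N \<Longrightarrow> minus_scalar (schroedinger f x) z \<psi> n = \<phi> n"
  shows "(\<Sum>n\<in>window N. (cmod (\<psi> n))\<^sup>2) \<le>
     2 / Im z * (Im (cnj (\<psi> (int N)) * \<psi> (int N + 1)) - Im (cnj (\<psi> (- int N - 1)) * \<psi> (- int N)))
     + (\<Sum>n\<in>window N. (cmod (\<phi> n))\<^sup>2) / (Im z)\<^sup>2"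
    (is "?S \<le> 2 / _ * ?B + ?T / _")
proof -
  have "Im z * ?S = ?B - (\<Sum>n\<in>window N. Im (cnj (\<psi> n) * \<phi> n))"
    using energy_identity[of z \<psi> N f x] \<phi> by simp
  also have "\<dots> \<le> ?B + (\<Sum>n\<in>window N. cmod (\<phi> n) * cmod (\<psi> n))"
    unfolding diff_conv_add_uminus sum_negf[symmetric]
  proof (intro add_left_mono sum_mono)
    fix n show "- Im (cnj (\<psi> n) * \<phi> n) \<le> cmod (\<phi> n) * cmod (\<psi> n)"
      using abs_Im_le_cmod[of "cnj (\<psi> n) * \<phi> n"] unfolding norm_mult by (simp add: mult.commute)
  qed
  also have "\<dots> \<le> ?B + (\<Sum>n\<in>window N. ((cmod (\<phi> n))\<^sup>2 / Im z + Im z * (cmod (\<psi> n))\<^sup>2) / 2)"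
    using z by (intro add_left_mono sum_mono weighted_AM_GM)
  also have "\<dots> = ?B + (?T / Im z + Im z * ?S) / 2"
    by (simp add: sum.distrib sum_divide_distrib[symmetric] sum_distrib_left[symmetric])
  finally have "Im z * ?S \<le> ?B + (?T / Im z + Im z * ?S) / 2" .
  moreover have "a \<le> 2 * b + t" if "a \<le> b + (t + a) / 2" for a b t :: real
    using that by argo
  ultimately have "Im z * ?S \<le> 2 * ?B + ?T / Im z" by blast
  then have "Im z * ?S \<le> Im z * (2 / Im z * ?B + ?T / (Im z)\<^sup>2)"
    using z by (simp add: distrib_left power2_eq_square)
  then show ?thesis using z by (simp add: mult_le_cancel_left_pos)
qed

text \<open>
The three-term recursion \<open>s (m + 2) + v m * s (m + 1) + s m = g m\<close> with \<open>s 0 = 0\<close> and free slope \<open>c\<close>.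
For an equation on the window \<open>{- N..N}\<close> the index \<open>m\<close> corresponds to the site \<open>m - N - 1\<close>, one step to the left of the window for \<open>m = 0\<close>.
\<close>
fun shoot :: "(nat \<Rightarrow> complex) \<Rightarrow> (nat \<Rightarrow> complex) \<Rightarrow> complex \<Rightarrow> nat \<Rightarrow> complex" where
  "shoot v g c 0 = 0"
| "shoot v g c (Suc 0) = c"
| "shoot v g c (Suc (Suc m)) = g m - v m * shoot v g c (Suc m) - shoot v g c m"

lemma shoot_affine: "shoot v g c m = shoot v g 0 m + c * shoot v (\<lambda>_. 0) 1 m"
  by (induction v g c m rule: shoot.induct) (simp_all add: algebra_simps)

lemma dirichlet_of_shoot:
  fixes N :: nat and f :: "nat \<Rightarrow> real" and x :: "int \<Rightarrow> nat" and z :: complex and g :: "int \<Rightarrow> complex"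
  defines "v \<equiv> \<lambda>m. of_real (f (x (int m - int N))) - z"
  assumes "shoot v (\<lambda>m. g (int m - int N)) c (2 * N + 2) = 0"
  defines "\<psi> \<equiv> \<lambda>n. if n \<in> window N then shoot v (\<lambda>m. g (int m - int N)) c (nat (n + int N + 1)) else 0"
  shows "\<And>n. n \<in> window N \<Longrightarrow> minus_scalar (schroedinger f x) z \<psi> n = g n"
proof -
  fix n assume n: "n \<in> window N"
  let ?s = "shoot v (\<lambda>m. g (int m - int N)) c"
  define m where "m = nat (n + int N)"
  have m: "n = int m - int N" "m \<le> 2 * N" using n by (auto simp: m_def)
  have "\<psi> (n + 1) = ?s (Suc (Suc m))"
  proof (cases "m = 2 * N")
    case True
    then show ?thesis using assms(2) m by (simp add: \<psi>_def del: shoot.simps)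
  next
    case False
    then have "nat (n + 1 + int N + 1) = Suc (Suc m)" "n + 1 \<in> window N" using m by auto
    then show ?thesis by (simp add: \<psi>_def del: shoot.simps)
  qed
  moreover have "\<psi> n = ?s (Suc m)"
  proof -
    have "nat (n + int N + 1) = Suc m" using m by auto
    then show ?thesis using n by (simp add: \<psi>_def del: shoot.simps)
  qed
  moreover have "\<psi> (n - 1) = ?s m"
  proof (cases "m = 0")
    case True
    then show ?thesis using m by (simp add: \<psi>_def)
  next
    case False
    then have "nat (n - 1 + int N + 1) = m" "n - 1 \<in> window N" using m by auto
    then show ?thesis by (simp add: \<psi>_def del: shoot.simps)
  qed
  ultimately show "minus_scalar (schroedinger f x) z \<psi> n = g n"
    by (simp add: minus_scalar_def schroedinger_def v_def m algebra_simps)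
qed

text \<open>
A shooting argument: the value at the right end is affine in the slope, and the homogeneous solution
does not vanish there, because otherwise it would be a Dirichlet eigenfunction for the
non-real energy \<open>z\<close>, which \<open>energy_bound\<close> excludes.
\<close>
lemma dirichlet_solution:
  assumes z: "0 < Im z"
  shows "\<exists>\<psi>. (\<forall>n. n \<notin> window N \<longrightarrow> \<psi> n = 0) \<and>
             (\<forall>n\<in>window N. minus_scalar (schroedinger f x) z \<psi> n = \<phi> n)"
proof -
  define v where "v m = of_real (f (x (int m - int N))) - z" for m
  define h where "h = shoot v (\<lambda>_. 0) 1"
  have "h (2 * N + 2) \<noteq> 0"
  proof
    assume h0: "h (2 * N + 2) = 0"
    define \<psi> where "\<psi> n = (if n \<in> window N then h (nat (n + int N + 1)) else 0)" for n
    have "minus_scalar (schroedinger f x) z \<psi> n = 0" if "n \<in> window N" for n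
      using dirichlet_of_shoot[of f x N z "\<lambda>_. 0" 1 n] h0 that
      unfolding h_def v_def \<psi>_def by simp
    then have "(\<Sum>n\<in>window N. (cmod (\<psi> n))\<^sup>2) \<le> 0"
      using energy_bound[OF z, of N f x \<psi> "\<lambda>_. 0"] by (simp add: \<psi>_def)
    moreover have "(cmod (\<psi> (- int N)))\<^sup>2 \<le> (\<Sum>n\<in>window N. (cmod (\<psi> n))\<^sup>2)"
      by (rule member_le_sum) auto
    ultimately have "(cmod (\<psi> (- int N)))\<^sup>2 \<le> 0" by linarith
    then have "\<psi> (- int N) = 0" by simp
    then show False by (simp add: \<psi>_def h_def)
  qed
  define g where "g m = \<phi> (int m - int N)" for m
  define c where "c = - shoot v g 0 (2 * N + 2) / h (2 * N + 2)"
  have s0: "shoot v g c (2 * N + 2) = 0"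
    using \<open>h (2 * N + 2) \<noteq> 0\<close> shoot_affine[of v g c "2 * N + 2"]
    by (simp add: c_def h_def del: shoot.simps)
  let ?\<psi> = "\<lambda>n. if n \<in> window N then shoot v g c (nat (n + int N + 1)) else 0"
  have "minus_scalar (schroedinger f x) z ?\<psi> n = \<phi> n" if "n \<in> window N" for n
    using dirichlet_of_shoot[of f x N z \<phi> c n] s0 that unfolding v_def g_def by simp
  then show ?thesis by (intro exI[of _ ?\<psi>]) simp
qed

lemma sum_window_limit_le:
  assumes "\<And>n. (\<lambda>j. g j n) \<longlonglongrightarrow> l n" "\<forall>\<^sub>F j in sequentially. (\<Sum>n\<in>F. (cmod (g j n))\<^sup>2) \<le> C"
  shows "(\<Sum>n\<in>F. (cmod (l n))\<^sup>2) \<le> C"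
proof -
  have "(\<lambda>j. \<Sum>n\<in>F. (cmod (g j n))\<^sup>2) \<longlonglongrightarrow> (\<Sum>n\<in>F. (cmod (l n))\<^sup>2)"
    by (intro tendsto_intros assms)
  then show ?thesis using assms(2) by (intro tendsto_upperbound) auto
qed

lemma minus_scalar_tendsto:
  assumes "\<And>n. (\<lambda>j. g j n) \<longlonglongrightarrow> l n" "w \<longlonglongrightarrow> z"
  shows "(\<lambda>j. minus_scalar (schroedinger f x) (w j) (g j) n) \<longlonglongrightarrow> minus_scalar (schroedinger f x) z l n"
  unfolding minus_scalar_def schroedinger_def by (intro tendsto_intros assms)

text \<open>
The Dirichlet solutions on growing windows have uniformly bounded norms, so a subsequence converges
pointwise, and the limit solves the equation on the whole line.
\<close>
lemma resolvent_equation_solvable: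
  assumes z: "0 < Im z" and \<phi>: "\<phi> \<in> l2"
  shows "\<exists>\<psi>\<in>l2. minus_scalar (schroedinger f x) z \<psi> = \<phi>"
proof -
  define C where "C = (l2_norm \<phi>)\<^sup>2 / (Im z)\<^sup>2"
  obtain g where g0: "\<And>N n. n \<notin> window N \<Longrightarrow> g N n = 0"
    and g: "\<And>N n. n \<in> window N \<Longrightarrow> minus_scalar (schroedinger f x) z (g N) n = \<phi> n"
    using dirichlet_solution[OF z, of _ f x \<phi>] by metis
  have win: "(\<Sum>n\<in>window N. (cmod (g N n))\<^sup>2) \<le> C" for N
  proof -
    have "(\<Sum>n\<in>window N. (cmod (g N n))\<^sup>2) \<le> (\<Sum>n\<in>window N. (cmod (\<phi> n))\<^sup>2) / (Im z)\<^sup>2"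
      using energy_bound[OF z, of N f x "g N" \<phi>] g g0[of _ N] by simp
    also have "\<dots> \<le> C" unfolding C_def using l2_sum_le[OF \<phi>] by (intro divide_right_mono) auto
    finally show ?thesis .
  qed
  have bd: "(\<Sum>n\<in>F. (cmod (g N n))\<^sup>2) \<le> C" if "finite F" for F N
  proof -
    have "(\<Sum>n\<in>F. (cmod (g N n))\<^sup>2) = (\<Sum>n\<in>F \<inter> window N. (cmod (g N n))\<^sup>2)"
      using that g0 by (intro sum.mono_neutral_right) auto
    also have "\<dots> \<le> (\<Sum>n\<in>window N. (cmod (g N n))\<^sup>2)" by (intro sum_mono2) auto
    finally show ?thesis using win[of N] by simp
  qed
  have "cmod (g N n) \<le> sqrt C" for N n
    using bd[of "{n}" N] by (simp add: real_le_rsqrt)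
  then obtain r l where r: "strict_mono r" and l: "\<And>n. (\<lambda>j. g (r j) n) \<longlonglongrightarrow> l n"
    using bounded_pointwise_subsequence[of g "sqrt C"] by blast
  have "l \<in> l2"
    using sum_window_limit_le[where g = "\<lambda>j. g (r j)", OF l] bd by (intro l2I[of _ C]) auto
  moreover have "minus_scalar (schroedinger f x) z l n = \<phi> n" for n
  proof -
    have "\<forall>\<^sub>F j in sequentially. minus_scalar (schroedinger f x) z (g (r j)) n = \<phi> n"
    proof (rule eventually_sequentiallyI[of "nat \<bar>n\<bar>"])
      fix j assume "nat \<bar>n\<bar> \<le> j"
      then have "n \<in> window (r j)" using seq_suble[OF r, of j] by (auto simp: abs_if split: if_splits)
      then show "minus_scalar (schroedinger f x) z (g (r j)) n = \<phi> n" by (rule g)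
    qed
    then have "(\<lambda>j. minus_scalar (schroedinger f x) z (g (r j)) n) \<longlonglongrightarrow> \<phi> n"
      by (rule tendsto_eventually)
    moreover have "(\<lambda>j. minus_scalar (schroedinger f x) z (g (r j)) n) \<longlonglongrightarrow> minus_scalar (schroedinger f x) z l n"
      by (intro minus_scalar_tendsto l tendsto_const)
    ultimately show ?thesis by (rule LIMSEQ_unique[symmetric])
  qed
  ultimately show ?thesis by blast
qed

lemma resolvent:
  assumes "0 < Im z" "\<phi> \<in> l2"
  shows "resolvent (schroedinger f x) z \<phi> \<in> l2"
    and "minus_scalar (schroedinger f x) z (resolvent (schroedinger f x) z \<phi>) = \<phi>"
proof -
  have "\<phi> \<in> minus_scalar (schroedinger f x) z ` l2"
    using resolvent_equation_solvable[OF assms, of f x] by blast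
  then show "resolvent (schroedinger f x) z \<phi> \<in> l2"
    "minus_scalar (schroedinger f x) z (resolvent (schroedinger f x) z \<phi>) = \<phi>"
    unfolding resolvent_def by (simp_all add: inv_into_into f_inv_into_f)
qed

lemma boundary_terms_vanish:
  assumes "\<psi> \<in> l2"
  shows "(\<lambda>N. Im (cnj (\<psi> (int N)) * \<psi> (int N + 1)) - Im (cnj (\<psi> (- int N - 1)) * \<psi> (- int N))) \<longlonglongrightarrow> 0"
proof -
  have "(\<lambda>N. Im (cnj (\<psi> (int N)) * \<psi> (int N + 1)) - Im (cnj (\<psi> (- int N - 1)) * \<psi> (- int N)))
      \<longlonglongrightarrow> Im (cnj 0 * 0) - Im (cnj 0 * 0)"
    using assms by (intro tendsto_intros l2_tendsto_zero) (auto simp: inj_def)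
  then show ?thesis by simp
qed

lemma resolvent_bound:
  assumes z: "0 < Im z" and \<phi>: "\<phi> \<in> l2" and F: "finite F"
  shows "(\<Sum>n\<in>F. (cmod (resolvent (schroedinger f x) z \<phi> n))\<^sup>2) \<le> (l2_norm \<phi>)\<^sup>2 / (Im z)\<^sup>2"
proof -
  define \<psi> where "\<psi> = resolvent (schroedinger f x) z \<phi>"
  have \<psi>: "\<psi> \<in> l2" "\<And>n. minus_scalar (schroedinger f x) z \<psi> n = \<phi> n"
    using resolvent[OF z \<phi>] by (simp_all add: \<psi>_def)
  let ?B = "\<lambda>N. Im (cnj (\<psi> (int N)) * \<psi> (int N + 1)) - Im (cnj (\<psi> (- int N - 1)) * \<psi> (- int N))"
  obtain M where M: "F \<subseteq> window M" using finite_subset_window F by blast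
  have le: "(\<Sum>n\<in>F. (cmod (\<psi> n))\<^sup>2) \<le> 2 / Im z * ?B N + (l2_norm \<phi>)\<^sup>2 / (Im z)\<^sup>2" if N: "M \<le> N" for N
  proof -
    have "(\<Sum>n\<in>F. (cmod (\<psi> n))\<^sup>2) \<le> (\<Sum>n\<in>window N. (cmod (\<psi> n))\<^sup>2)"
      using M N by (intro sum_mono2) (auto simp: subset_iff)
    also have "\<dots> \<le> 2 / Im z * ?B N + (\<Sum>n\<in>window N. (cmod (\<phi> n))\<^sup>2) / (Im z)\<^sup>2"
      using energy_bound[OF z \<psi>(2)] .
    also have "\<dots> \<le> 2 / Im z * ?B N + (l2_norm \<phi>)\<^sup>2 / (Im z)\<^sup>2"
      using l2_sum_le[OF \<phi>] by (intro add_left_mono divide_right_mono) auto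
    finally show ?thesis .
  qed
  have "(\<lambda>N. 2 / Im z * ?B N + (l2_norm \<phi>)\<^sup>2 / (Im z)\<^sup>2) \<longlonglongrightarrow> 2 / Im z * 0 + (l2_norm \<phi>)\<^sup>2 / (Im z)\<^sup>2"
    by (intro tendsto_intros boundary_terms_vanish[OF \<psi>(1)])
  then have "(\<Sum>n\<in>F. (cmod (\<psi> n))\<^sup>2) \<le> 2 / Im z * 0 + (l2_norm \<phi>)\<^sup>2 / (Im z)\<^sup>2"
    by (rule LIMSEQ_le_const) (use le in blast)
  then show ?thesis by (simp add: \<psi>_def)
qed

section \<open>Pure point spectral measures come from eigenfunctions\<close>

lemma LINT_singleton:
  fixes c :: complex
  assumes "sets \<mu> = sets borel" "finite_measure \<mu>"
  shows "(LINT t|\<mu>. indicator {t0 :: real} t *\<^sub>R c) = measure \<mu> {t0} *\<^sub>R c"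
proof -
  interpret finite_measure \<mu> by fact
  have "{t0} \<in> sets \<mu>" using assms(1) by simp
  then show ?thesis by (simp add: less_top[symmetric])
qed

text \<open>
Pointwise \<open>\<epsilon> / (t - t0 - i \<epsilon>)\<close> tends to \<open>i\<close> at \<open>t = t0\<close> and to \<open>0\<close> elsewhere, and it is bounded by \<open>1\<close>.
\<close>
lemma rescaled_Cauchy_transform_tendsto:
  fixes \<mu> :: "real measure" and t0 :: real
  defines "\<epsilon> \<equiv> \<lambda>j. inverse (real (Suc j))"
  assumes \<mu>: "sets \<mu> = sets borel" "finite_measure \<mu>"
  shows "(\<lambda>j. of_real (\<epsilon> j) * (LINT t|\<mu>. 1 / (of_real t - Complex t0 (\<epsilon> j)))) \<longlonglongrightarrow> measure \<mu> {t0} *\<^sub>R \<i>"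
proof -
  interpret finite_measure \<mu> by fact
  have \<epsilon>: "0 < \<epsilon> j" for j by (simp add: \<epsilon>_def)
  have \<epsilon>0: "\<epsilon> \<longlonglongrightarrow> 0" unfolding \<epsilon>_def by (rule LIMSEQ_inverse_real_of_nat)
  let ?g = "\<lambda>j t. of_real (\<epsilon> j) / (of_real t - Complex t0 (\<epsilon> j))"
  have meas: "?g j \<in> borel_measurable \<mu>" for j
  proof -
    have "?g j \<in> borel_measurable borel" by measurable
    then show ?thesis using measurable_cong_sets[OF \<mu>(1) refl] by blast
  qed
  have "(\<lambda>j. LINT t|\<mu>. ?g j t) \<longlonglongrightarrow> (LINT t|\<mu>. indicator {t0} t *\<^sub>R \<i>)"
  proof (rule integral_dominated_convergence[where w = "\<lambda>_. 1"])
    show "(\<lambda>t. indicator {t0} t *\<^sub>R \<i>) \<in> borel_measurable \<mu>"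
      using \<mu>(1) by (simp add: measurable_cong_sets[OF \<mu>(1) refl])
    show "AE t in \<mu>. (\<lambda>j. ?g j t) \<longlonglongrightarrow> indicator {t0} t *\<^sub>R \<i>"
    proof (rule AE_I2)
      fix t
      show "(\<lambda>j. ?g j t) \<longlonglongrightarrow> indicator {t0} t *\<^sub>R \<i>"
      proof (cases "t = t0")
        case True
        have "?g j t = \<i>" for j
          using \<epsilon>[of j] True by (simp add: complex_eq_iff Re_divide Im_divide power2_eq_square)
        then show ?thesis using True by simp
      next
        case False
        have "(\<lambda>j. Complex t0 (\<epsilon> j)) \<longlonglongrightarrow> Complex t0 0" by (intro tendsto_Complex tendsto_const \<epsilon>0)
        then have "(\<lambda>j. ?g j t) \<longlonglongrightarrow> of_real 0 / (of_real t - Complex t0 0)"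
          using False by (intro tendsto_intros \<epsilon>0) (auto simp: complex_eq_iff)
        then show ?thesis using False by simp
      qed
    qed
    show "AE t in \<mu>. norm (?g j t) \<le> 1" for j
    proof (rule AE_I2)
      fix t
      have "\<epsilon> j \<le> cmod (of_real t - Complex t0 (\<epsilon> j))"
        using abs_Im_le_cmod[of "of_real t - Complex t0 (\<epsilon> j)"] \<epsilon>[of j] by simp
      then show "norm (?g j t) \<le> 1"
        using \<epsilon>[of j] by (simp add: norm_divide divide_le_eq_1)
    qed
  qed (use meas in simp_all)
  then have "(\<lambda>j. LINT t|\<mu>. ?g j t) \<longlonglongrightarrow> measure \<mu> {t0} *\<^sub>R \<i>"
    using LINT_singleton[OF \<mu>, of t0 \<i>] by simp
  moreover have "(LINT t|\<mu>. ?g j t) = of_real (\<epsilon> j) * (LINT t|\<mu>. 1 / (of_real t - Complex t0 (\<epsilon> j)))" for j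
    by (subst integral_mult_right_zero[symmetric]) simp
  ultimately show ?thesis by simp
qed

text \<open>
The vectors \<open>g = \<epsilon> (H - t0 - i \<epsilon>)\<inverse> \<phi>\<close> satisfy \<open>(H - t0 - i \<epsilon>) g = \<epsilon> \<phi>\<close>, with right-hand side tending
to zero, and their norms are at most that of \<open>\<phi>\<close>. The atom keeps \<open>\<langle>\<phi>, g\<rangle>\<close> away from zero, so that
a pointwise limit cannot be zero.
\<close>
lemma atom_is_eigenvalue:
  assumes \<phi>: "\<phi> \<in> l2" and sp: "is_spectral_measure (schroedinger f x) \<phi> \<mu>"
    and atom: "measure \<mu> {t0} \<noteq> 0"
  shows "\<exists>u\<in>l2. u \<noteq> (\<lambda>_. 0) \<and> (\<forall>n. schroedinger f x u n = of_real t0 * u n)"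
proof -
  let ?H = "schroedinger f x"
  define \<epsilon> where "\<epsilon> j = inverse (real (Suc j))" for j
  define z where "z j = Complex t0 (\<epsilon> j)" for j
  have \<epsilon>: "0 < \<epsilon> j" for j by (simp add: \<epsilon>_def)
  have \<epsilon>0: "\<epsilon> \<longlonglongrightarrow> 0" unfolding \<epsilon>_def by (rule LIMSEQ_inverse_real_of_nat)
  have z: "0 < Im (z j)" for j using \<epsilon> by (simp add: z_def)
  have z0: "z \<longlonglongrightarrow> of_real t0"
    unfolding z_def complex_of_real_def by (intro tendsto_Complex tendsto_const \<epsilon>0)
  define R where "R j = resolvent ?H (z j) \<phi>" for j
  define g where "g j n = of_real (\<epsilon> j) * R j n" for j n
  define C where "C = (l2_norm \<phi>)\<^sup>2"
  have bd: "(\<Sum>n\<in>F. (cmod (g j n))\<^sup>2) \<le> C" if "finite F" for F j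
  proof -
    have "(\<Sum>n\<in>F. (cmod (g j n))\<^sup>2) = (\<epsilon> j)\<^sup>2 * (\<Sum>n\<in>F. (cmod (R j n))\<^sup>2)"
      by (simp add: g_def norm_mult power_mult_distrib sum_distrib_left)
    also have "\<dots> \<le> (\<epsilon> j)\<^sup>2 * (C / (\<epsilon> j)\<^sup>2)"
      using resolvent_bound[OF z \<phi> that, of f x j] unfolding R_def C_def
      by (intro mult_left_mono) (simp_all add: z_def)
    finally show ?thesis using \<epsilon>[of j] by simp
  qed
  have gl2: "g j \<in> l2" for j using bd by (intro l2I) auto
  have gnorm: "(l2_norm (g j))\<^sup>2 \<le> C" for j
  proof -
    have "(\<Sum>\<^sub>\<infinity>n. (cmod (g j n))\<^sup>2) \<le> C"
      using gl2[of j] bd by (intro infsum_le_finite_sums) (auto simp: l2_def)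
    then show ?thesis by (simp add: l2_norm_def infsum_nonneg)
  qed
  have "cmod (g j n) \<le> sqrt C" for j n
    using bd[of "{n}" j] by (simp add: real_le_rsqrt)
  then obtain r u where r: "strict_mono r" and u: "\<And>n. (\<lambda>j. g (r j) n) \<longlonglongrightarrow> u n"
    using bounded_pointwise_subsequence[of g "sqrt C"] by blast
  have "u \<in> l2"
    using sum_window_limit_le[where g = "\<lambda>j. g (r j)", OF u] bd by (intro l2I[of _ C]) auto
  moreover have "?H u n = of_real t0 * u n" for n
  proof -
    have "minus_scalar ?H (z j) (g j) n = of_real (\<epsilon> j) * \<phi> n" for j
    proof -
      have "minus_scalar ?H (z j) (g j) n = of_real (\<epsilon> j) * minus_scalar ?H (z j) (R j) n"
        by (simp add: minus_scalar_def schroedinger_def g_def algebra_simps)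
      then show ?thesis using resolvent(2)[OF z \<phi>, of f x j] by (simp add: R_def)
    qed
    moreover have "(\<lambda>j. minus_scalar ?H (z (r j)) (g (r j)) n) \<longlonglongrightarrow> minus_scalar ?H (of_real t0) u n"
      using LIMSEQ_subseq_LIMSEQ[OF z0 r] by (intro minus_scalar_tendsto u) (simp add: o_def)
    moreover have "(\<lambda>j. of_real (\<epsilon> (r j)) * \<phi> n) \<longlonglongrightarrow> of_real 0 * \<phi> n"
      using LIMSEQ_subseq_LIMSEQ[OF \<epsilon>0 r] by (intro tendsto_intros) (simp add: o_def)
    ultimately have "minus_scalar ?H (of_real t0) u n = of_real 0 * \<phi> n"
      by (simp add: LIMSEQ_unique)
    then show ?thesis by (simp add: minus_scalar_def)
  qed
  moreover have "u \<noteq> (\<lambda>_. 0)"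
  proof
    assume "u = (\<lambda>_. 0)"
    then have "(\<lambda>j. l2_inner \<phi> (g (r j))) \<longlonglongrightarrow> 0"
      using u by (intro l2_inner_weak_limit[OF \<phi> gl2 gnorm]) auto
    moreover have "(\<lambda>j. l2_inner \<phi> (g j)) \<longlonglongrightarrow> measure \<mu> {t0} *\<^sub>R \<i>"
    proof -
      have "l2_inner \<phi> (g j) = of_real (\<epsilon> j) * l2_inner \<phi> (R j)" for j
        unfolding l2_inner_def g_def
        by (subst infsum_cmult_right'[symmetric]) (simp add: mult.left_commute)
      moreover have "l2_inner \<phi> (R j) = (LINT t|\<mu>. 1 / (of_real t - z j))" for j
        using sp z[of j] by (simp add: is_spectral_measure_def R_def)
      ultimately show ?thesis
        using rescaled_Cauchy_transform_tendsto[of \<mu> t0] sp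
        by (simp add: is_spectral_measure_def z_def \<epsilon>_def)
    qed
    then have "(\<lambda>j. l2_inner \<phi> (g (r j))) \<longlonglongrightarrow> measure \<mu> {t0} *\<^sub>R \<i>"
      using LIMSEQ_subseq_LIMSEQ[OF _ r] by (fastforce simp: o_def)
    ultimately have "measure \<mu> {t0} *\<^sub>R \<i> = 0" by (rule LIMSEQ_unique[symmetric])
    then show False using atom by simp
  qed
  ultimately show ?thesis by blast
qed

text \<open>
For \<open>\<psi> = (H - z)\<inverse> \<phi>\<close> the energy identity says that \<open>Im z\<close> times the square norm of \<open>\<psi>\<close> is the imaginary
part of \<open>\<langle>\<phi>, \<psi>\<rangle>\<close>.
\<close>
lemma zero_of_zero_Cauchy_transform:
  assumes \<phi>: "\<phi> \<in> l2" and z: "0 < Im z"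
    and 0: "l2_inner \<phi> (resolvent (schroedinger f x) z \<phi>) = 0"
  shows "\<phi> = (\<lambda>_. 0)"
proof -
  define \<psi> where "\<psi> = resolvent (schroedinger f x) z \<phi>"
  have \<psi>: "\<psi> \<in> l2" "minus_scalar (schroedinger f x) z \<psi> = \<phi>"
    using resolvent[OF z \<phi>] by (simp_all add: \<psi>_def)
  let ?S = "\<lambda>N. \<Sum>n\<in>window N. (cmod (\<psi> n))\<^sup>2"
  have "(\<lambda>N. Im (\<Sum>n\<in>window N. cnj (\<phi> n) * \<psi> n)) \<longlonglongrightarrow> Im 0"
    using l2_inner_window[OF \<phi> \<psi>(1)] 0 unfolding \<psi>_def[symmetric] by (intro tendsto_Im) simp
  then have "(\<lambda>N. (Im (cnj (\<psi> (int N)) * \<psi> (int N + 1)) - Im (cnj (\<psi> (- int N - 1)) * \<psi> (- int N)))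
      + Im (\<Sum>n\<in>window N. cnj (\<phi> n) * \<psi> n)) \<longlonglongrightarrow> 0 + Im 0"
    using boundary_terms_vanish[OF \<psi>(1)] by (intro tendsto_add)
  moreover have "Im z * ?S N = (Im (cnj (\<psi> (int N)) * \<psi> (int N + 1)) - Im (cnj (\<psi> (- int N - 1)) * \<psi> (- int N)))
      + Im (\<Sum>n\<in>window N. cnj (\<phi> n) * \<psi> n)" for N
  proof -
    have "Im (\<Sum>n\<in>window N. cnj (\<phi> n) * \<psi> n) = - (\<Sum>n\<in>window N. Im (cnj (\<psi> n) * \<phi> n))"
      unfolding Im_sum sum_negf[symmetric] by (intro sum.cong) auto
    then show ?thesis using energy_identity[of z \<psi> N f x] \<psi>(2) by simp
  qed
  ultimately have lim: "(\<lambda>N. Im z * ?S N) \<longlonglongrightarrow> 0" by simp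
  have "\<psi> n = 0" for n
  proof -
    have "Im z * (cmod (\<psi> n))\<^sup>2 \<le> Im z * ?S N" if "nat \<bar>n\<bar> \<le> N" for N
    proof -
      have "n \<in> window N" using that by auto
      then have "(cmod (\<psi> n))\<^sup>2 \<le> ?S N" by (intro member_le_sum) auto
      then show ?thesis using z by simp
    qed
    then have "Im z * (cmod (\<psi> n))\<^sup>2 \<le> 0" using LIMSEQ_le_const[OF lim] by blast
    then show ?thesis using z by (simp add: mult_le_0_iff)
  qed
  then have "minus_scalar (schroedinger f x) z \<psi> = (\<lambda>_. 0)"
    by (simp add: minus_scalar_def schroedinger_def fun_eq_iff)
  then show ?thesis using \<psi>(2) by simp
qed

lemma sigma_pp_empty_if_no_eigenfunction:
  assumes none: "\<And>u E. u \<in> l2 \<Longrightarrow> (\<And>n. schroedinger f x u n = of_real E * u n) \<Longrightarrow> u = (\<lambda>_. 0)"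
  shows "sigma_pp (schroedinger f x) = {}"
proof -
  let ?H = "schroedinger f x"
  have zero: "\<phi> = (\<lambda>_. 0)" if pp: "\<phi> \<in> H_pp ?H" for \<phi>
  proof -
    obtain \<mu> where \<phi>: "\<phi> \<in> l2" and sp: "is_spectral_measure ?H \<phi> \<mu>" and "pure_point \<mu>"
      using pp by (auto simp: H_pp_def)
    then obtain S where S: "countable S" "emeasure \<mu> (UNIV - S) = 0" by (auto simp: pure_point_def)
    have sets: "sets \<mu> = sets borel" and fin: "finite_measure \<mu>"
      using sp by (auto simp: is_spectral_measure_def)
    interpret finite_measure \<mu> by fact
    have sp_UNIV: "space \<mu> = UNIV" using sets_eq_imp_space_eq[OF sets] by simp
    have S_sets: "S \<in> sets \<mu>" by (rule sets.countable[OF _ S(1)]) (simp add: sets)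
    have "measure \<mu> {t} = 0" for t
    proof (rule ccontr)
      assume "measure \<mu> {t} \<noteq> 0"
      then obtain u where u: "u \<in> l2" "u \<noteq> (\<lambda>_. 0)" and eq: "\<forall>n. ?H u n = of_real t * u n"
        using atom_is_eigenvalue[OF \<phi> sp] by blast
      have "u = (\<lambda>_. 0)" by (rule none[OF u(1)]) (rule eq[rule_format])
      then show False using u(2) by contradiction
    qed
    then have "\<forall>t\<in>S. {t} \<in> null_sets \<mu>" by (simp add: null_sets_def sets emeasure_eq_measure)
    then have "(\<Union>t\<in>S. {t}) \<in> null_sets \<mu>" using S(1) by (intro null_sets_UN') auto
    moreover have "UNIV - S \<in> null_sets \<mu>" using S sets.compl_sets[OF S_sets] sp_UNIV by (auto simp: null_sets_def)
    ultimately have "(\<Union>t\<in>S. {t}) \<union> (UNIV - S) \<in> null_sets \<mu>" by (rule null_sets.Un)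
    then have "UNIV \<in> null_sets \<mu>" by simp
    then have AE: "AE t in \<mu>. False" by (auto intro: AE_I'[of UNIV])
    have "(LINT t|\<mu>. 1 / (of_real t - \<i>)) = (LINT t|\<mu>. 0 :: complex)"
      using AE by (intro integral_cong_AE) (auto simp: measurable_cong_sets[OF sets refl])
    then have "l2_inner \<phi> (resolvent ?H \<i> \<phi>) = 0"
      using sp by (simp add: is_spectral_measure_def)
    then show ?thesis using zero_of_zero_Cauchy_transform[OF \<phi>, of \<i>] by simp
  qed
  have H0: "minus_scalar ?H z (\<lambda>_. 0) = (\<lambda>_. 0)" for z
    by (simp add: minus_scalar_def schroedinger_def fun_eq_iff)
  \<comment> \<open>Every map fixing zero is a bijection of \<open>{0}\<close>, and of the empty set.\<close>
  have "z \<notin> spectrum_on (H_pp ?H) ?H" for z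
  proof -
    have "bij_betw (minus_scalar ?H z) (H_pp ?H) (H_pp ?H)"
    proof (rule bij_betwI[where g = id])
      show "minus_scalar ?H z \<in> H_pp ?H \<rightarrow> H_pp ?H"
        using zero H0 by (metis (no_types, lifting) Pi_I)
      show "id (minus_scalar ?H z \<phi>) = \<phi>" if "\<phi> \<in> H_pp ?H" for \<phi>
        using zero[OF that] by (simp add: H0)
      show "minus_scalar ?H z (id \<phi>) = \<phi>" if "\<phi> \<in> H_pp ?H" for \<phi>
        using zero[OF that] by (simp add: H0)
    qed simp
    moreover have "\<forall>\<phi>\<in>H_pp ?H. l2_norm \<phi> \<le> 1 * l2_norm (minus_scalar ?H z \<phi>)"
      using zero H0 by (metis (no_types, lifting) mult_1 order_refl)
    ultimately show ?thesis unfolding spectrum_on_def by blast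
  qed
  then show ?thesis unfolding sigma_pp_def by blast
qed

section \<open>Many long palindromes exclude eigenfunctions\<close>

lemma small_factor:
  fixes a b :: complex
  assumes "cmod (a * b) \<le> \<delta>\<^sup>2" "0 \<le> \<delta>"
  shows "cmod a \<le> \<delta> \<or> cmod b \<le> \<delta>"
proof (rule ccontr)
  assume "\<not> ?thesis"
  then have "\<delta> * \<delta> < cmod a * cmod b" using assms(2) by (intro mult_strict_mono) auto
  then show False using assms(1) by (simp add: norm_mult power2_eq_square)
qed

text \<open>
The Wronskian of \<open>u\<close> and its reflection is constant on the interval of symmetry, and its sum over
\<open>L + 1\<close> sites is bounded by four sums, each at most half the square norm of \<open>u\<close>.
\<close>
lemma reflected_wronskian_bound:
  assumes u: "u \<in> l2" and eq: "\<And>n. schroedinger f x u n = of_real E * u n"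
    and sym: "reflection_symmetric x s L" and n: "0 \<le> n" "n \<le> int L"
  shows "cmod (u (n + 1) * u (int s - n) - u n * u (int s - n - 1)) \<le> 2 * (l2_norm u)\<^sup>2 / (real L + 1)"
proof -
  define v where "v n = u (int s - n)" for n
  define W where "W n = u (n + 1) * v n - u n * v (n + 1)" for n
  have step_u: "u (n + 1) = (of_real E - of_real (f (x n))) * u n - u (n - 1)" for n
    using eq[of n] by (simp add: schroedinger_def algebra_simps)
  have step_v: "v (n + 1) = (of_real E - of_real (f (x n))) * v n - v (n - 1)" if "\<bar>n\<bar> \<le> int L" for n
  proof -
    have "x (int s - n) = x n" using sym that by (simp add: reflection_symmetric_def)
    then show ?thesis using eq[of "int s - n"] by (simp add: schroedinger_def v_def algebra_simps)
  qed
  have const: "W n = W (n - 1)" if "\<bar>n\<bar> \<le> int L" for n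
    unfolding W_def step_u[of n] step_v[OF that] by (simp add: algebra_simps)
  have W0: "W (int j) = W 0" if "j \<le> L" for j
    using that
  proof (induction j)
    case (Suc j)
    then show ?case using const[of "int (Suc j)"] by simp
  qed simp
  have sum_le: "(\<Sum>n\<in>{0..int L}. (cmod (u (e n)))\<^sup>2) \<le> (l2_norm u)\<^sup>2" if "inj e" for e
  proof -
    have "(\<Sum>n\<in>{0..int L}. (cmod (u (e n)))\<^sup>2) = (\<Sum>n\<in>e ` {0..int L}. (cmod (u n))\<^sup>2)"
      using that by (subst sum.reindex) (auto simp: inj_on_def)
    then show ?thesis using l2_sum_le[OF u] by simp
  qed
  have "(real L + 1) * cmod (W 0) = (\<Sum>n\<in>{0..int L}. cmod (W n))"
  proof -
    have "(\<Sum>n\<in>{0..int L}. cmod (W n)) = (\<Sum>n\<in>{0..int L}. cmod (W 0))"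
    proof (rule sum.cong)
      fix n assume "n \<in> {0..int L}"
      then show "cmod (W n) = cmod (W 0)" using W0[of "nat n"] by (simp add: nat_le_iff)
    qed simp
    then show ?thesis by simp
  qed
  also have "\<dots> \<le> (\<Sum>n\<in>{0..int L}. ((cmod (u (n + 1)))\<^sup>2 + (cmod (u (int s - n)))\<^sup>2
      + (cmod (u n))\<^sup>2 + (cmod (u (int s - n - 1)))\<^sup>2) / 2)"
  proof (rule sum_mono)
    fix n
    have "cmod (W n) \<le> cmod (u (n + 1)) * cmod (v n) + cmod (u n) * cmod (v (n + 1))"
      unfolding W_def by (metis norm_mult norm_triangle_ineq4)
    also have "\<dots> \<le> ((cmod (u (n + 1)))\<^sup>2 + (cmod (v n))\<^sup>2) / 2 + ((cmod (u n))\<^sup>2 + (cmod (v (n + 1)))\<^sup>2) / 2"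
      using weighted_AM_GM[of 1 "cmod (u (n + 1))" "cmod (v n)"] weighted_AM_GM[of 1 "cmod (u n)" "cmod (v (n + 1))"]
      by (intro add_mono) simp_all
    finally show "cmod (W n) \<le> ((cmod (u (n + 1)))\<^sup>2 + (cmod (u (int s - n)))\<^sup>2
      + (cmod (u n))\<^sup>2 + (cmod (u (int s - n - 1)))\<^sup>2) / 2"
      by (simp add: v_def algebra_simps add_divide_distrib)
  qed
  also have "\<dots> = ((\<Sum>n\<in>{0..int L}. (cmod (u (n + 1)))\<^sup>2) + (\<Sum>n\<in>{0..int L}. (cmod (u (int s - n)))\<^sup>2)
      + (\<Sum>n\<in>{0..int L}. (cmod (u n))\<^sup>2) + (\<Sum>n\<in>{0..int L}. (cmod (u (int s - n - 1)))\<^sup>2)) / 2"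
    by (simp add: sum.distrib sum_divide_distrib[symmetric])
  also have "\<dots> \<le> 2 * (l2_norm u)\<^sup>2"
    using sum_le[of "\<lambda>n. n + 1"] sum_le[of "\<lambda>n. int s - n"] sum_le[of "\<lambda>n. n"] sum_le[of "\<lambda>n. int s - n - 1"]
    by (simp add: inj_def)
  finally have "cmod (W 0) \<le> 2 * (l2_norm u)\<^sup>2 / (real L + 1)"
    by (simp add: field_simps)
  moreover have "W n = W 0" using W0[of "nat n"] n by simp
  moreover have "W n = u (n + 1) * u (int s - n) - u n * u (int s - n - 1)"
    by (simp add: W_def v_def algebra_simps)
  ultimately show ?thesis by simp
qed

text \<open>
At the centre the Wronskian is a product. For even \<open>s = 2 m\<close> its factors are \<open>u m\<close> and
\<open>u (m + 1) - u (m - 1)\<close>; if the first is small, the eigenvalue equation makes \<open>u (m + 1) + u (m - 1)\<close>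
small too. For odd \<open>s = 2 m + 1\<close> the factors are the difference and the sum of \<open>u m\<close> and \<open>u (m + 1)\<close>.
In each case \<open>u\<close> plus or minus its reflection is small at the two sites \<open>m\<close> and \<open>m + 1\<close>, that is, it has
small initial data.
\<close>
lemma reflected_centre:
  assumes eq: "\<And>n. schroedinger f x u n = of_real E * u n" and V: "\<And>n. \<bar>f (x n)\<bar> \<le> M"
    and \<delta>: "0 \<le> \<delta>"
    and W: "cmod (u (int (s div 2) + 1) * u (int s - int (s div 2)) - u (int (s div 2)) * u (int s - int (s div 2) - 1)) \<le> \<delta>\<^sup>2"
  shows "\<exists>\<sigma>\<in>{1, -1}. \<forall>n\<in>{int (s div 2), int (s div 2) + 1}. cmod (u n + \<sigma> * u (int s - n)) \<le> (\<bar>E\<bar> + M + 2) * \<delta>"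
proof -
  define m where "m = int (s div 2)"
  have M: "0 \<le> M" using V[of 0] by linarith
  have D: "\<delta> \<le> (\<bar>E\<bar> + M + 2) * \<delta>" "2 * \<delta> \<le> (\<bar>E\<bar> + M + 2) * \<delta>" "(\<bar>E\<bar> + M) * \<delta> \<le> (\<bar>E\<bar> + M + 2) * \<delta>"
    using \<delta> M mult_right_mono[of 1 "\<bar>E\<bar> + M + 2" \<delta>] by (auto intro!: mult_right_mono)
  consider (even) "int s = 2 * m" | (odd) "int s = 2 * m + 1"
    unfolding m_def by linarith
  then show ?thesis
  proof cases
    case even
    have r: "int s - m = m" "int s - m - 1 = m - 1" "int s - (m + 1) = m - 1" using even by auto
    have "cmod (u m * (u (m + 1) - u (m - 1))) \<le> \<delta>\<^sup>2"
      using W unfolding m_def[symmetric] r by (simp add: algebra_simps)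
    then consider "cmod (u m) \<le> \<delta>" | "cmod (u (m + 1) - u (m - 1)) \<le> \<delta>"
      using small_factor \<delta> by blast
    then show ?thesis
    proof cases
      case 1
      have "u (m + 1) + u (m - 1) = of_real (E - f (x m)) * u m"
        using eq[of m] by (simp add: schroedinger_def algebra_simps)
      then have "cmod (u (m + 1) + u (m - 1)) = \<bar>E - f (x m)\<bar> * cmod (u m)"
        by (simp only: norm_mult norm_of_real)
      also have "\<dots> \<le> (\<bar>E\<bar> + M) * \<delta>" using 1 V[of m] M by (intro mult_mono) auto
      finally have "cmod (u (m + 1) + u (m - 1)) \<le> (\<bar>E\<bar> + M + 2) * \<delta>" using D by linarith
      moreover have "cmod (u m + u m) \<le> (\<bar>E\<bar> + M + 2) * \<delta>"
        using 1 D(2) norm_triangle_ineq[of "u m" "u m"] by linarith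
      ultimately show ?thesis unfolding m_def[symmetric] by (intro bexI[of _ 1]) (auto simp: r)
    next
      case 2
      then show ?thesis using D(1) \<delta> M unfolding m_def[symmetric] by (intro bexI[of _ "-1"]) (auto simp: r)
    qed
  next
    case odd
    have r: "int s - m = m + 1" "int s - m - 1 = m" "int s - (m + 1) = m" using odd by auto
    have "cmod ((u (m + 1) - u m) * (u (m + 1) + u m)) \<le> \<delta>\<^sup>2"
      using W unfolding m_def[symmetric] r by (simp add: algebra_simps)
    then consider "cmod (u (m + 1) - u m) \<le> \<delta>" | "cmod (u (m + 1) + u m) \<le> \<delta>"
      using small_factor \<delta> by blast
    then show ?thesis
    proof cases
      case 1
      then show ?thesis using D(1) norm_minus_commute[of "u m" "u (m + 1)"] unfolding m_def[symmetric]
        by (intro bexI[of _ "-1"]) (auto simp: r)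
    next
      case 2
      then have "cmod (u (m + 1) + u m) \<le> (\<bar>E\<bar> + M + 2) * \<delta>" using D(1) by linarith
      moreover from this have "cmod (u m + u (m + 1)) \<le> (\<bar>E\<bar> + M + 2) * \<delta>"
        unfolding add.commute[of "u m" "u (m + 1)"] .
      ultimately show ?thesis unfolding m_def[symmetric]
        by (intro bexI[of _ 1]) (auto simp: r)
    qed
  qed
qed

text \<open>
The combination \<open>w\<close> of \<open>u\<close> and its reflection that is small at the centre solves the eigenvalue
equation, so it grows at most by the factor \<open>B\<close> in each step from the centre back to the origin.
\<close>
lemma reflected_difference_at_origin:
  assumes u: "u \<in> l2" and eq: "\<And>n. schroedinger f x u n = of_real E * u n" and V: "\<And>n. \<bar>f (x n)\<bar> \<le> M"
    and sym: "reflection_symmetric x s L" and sL: "s \<le> L"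
    and n: "n \<in> {0, 1}" and le: "cmod (u (int s - n)) \<le> cmod (u n)"
  shows "(cmod (u n) - cmod (u (int s - n)))\<^sup>2 \<le> (\<bar>E\<bar> + M + 2) ^ (s + 2) * (2 * (l2_norm u)\<^sup>2 / (real L + 1))"
proof -
  define B where "B = \<bar>E\<bar> + M + 2"
  define m where "m = s div 2"
  define \<delta> where "\<delta> = sqrt (2 * (l2_norm u)\<^sup>2 / (real L + 1))"
  have M: "0 \<le> M" using V[of 0] by linarith
  have B: "1 \<le> B" using M by (simp add: B_def)
  have \<delta>: "0 \<le> \<delta>" "\<delta>\<^sup>2 = 2 * (l2_norm u)\<^sup>2 / (real L + 1)" by (simp_all add: \<delta>_def)
  obtain \<sigma> :: complex where \<sigma>: "\<sigma> \<in> {1, -1}"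
    and centre: "\<And>n. n \<in> {int m, int m + 1} \<Longrightarrow> cmod (u n + \<sigma> * u (int s - n)) \<le> B * \<delta>"
    using reflected_centre[OF eq V \<delta>(1), of s] reflected_wronskian_bound[OF u eq sym, of "int m"] sL \<delta>(2)
    unfolding m_def B_def by fastforce
  define w where "w n = u n + \<sigma> * u (int s - n)" for n
  have step_w: "w (n - 1) = of_real (E - f (x n)) * w n - w (n + 1)" if "\<bar>n\<bar> \<le> int L" for n
  proof -
    have "x (int s - n) = x n" using sym that by (simp add: reflection_symmetric_def)
    then have "u (int s - n + 1) + u (int s - n - 1) = of_real (E - f (x n)) * u (int s - n)"
      "u (n + 1) + u (n - 1) = of_real (E - f (x n)) * u n"
      using eq[of n] eq[of "int s - n"] by (simp_all add: schroedinger_def algebra_simps)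
    then have "u (n + 1) + u (n - 1) + \<sigma> * (u (int s - n + 1) + u (int s - n - 1))
        = of_real (E - f (x n)) * (u n + \<sigma> * u (int s - n))"
      by (simp only: distrib_left mult.left_commute)
    moreover have "int s - (n - 1) = int s - n + 1" "int s - (n + 1) = int s - n - 1" by simp_all
    ultimately show ?thesis unfolding w_def by (simp add: algebra_simps)
  qed
  have propagate: "cmod (w (int (m - j))) \<le> B ^ (j + 1) * \<delta> \<and> cmod (w (int (m - j) + 1)) \<le> B ^ (j + 1) * \<delta>" if "j \<le> m" for j
    using that
  proof (induction j)
    case 0
    then show ?case using centre by (auto simp: w_def)
  next
    case (Suc j)
    define i where "i = int (m - j)"
    have i: "int (m - Suc j) = i - 1" using Suc.prems by (simp add: i_def)
    have IH: "cmod (w i) \<le> B ^ (j + 1) * \<delta>" "cmod (w (i + 1)) \<le> B ^ (j + 1) * \<delta>"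
      using Suc by (simp_all add: i_def)
    have c: "0 \<le> B ^ (j + 1) * \<delta>" using B \<delta> by simp
    have iL: "\<bar>i\<bar> \<le> int L" using sL by (auto simp: i_def m_def)
    have "cmod (w (i - 1)) \<le> cmod (of_real (E - f (x i)) * w i) + cmod (w (i + 1))"
      unfolding step_w[OF iL] by (rule norm_triangle_ineq4)
    also have "\<dots> = \<bar>E - f (x i)\<bar> * cmod (w i) + cmod (w (i + 1))"
      by (simp only: norm_mult norm_of_real)
    also have "\<dots> \<le> (\<bar>E\<bar> + M) * (B ^ (j + 1) * \<delta>) + B ^ (j + 1) * \<delta>"
      using IH V[of i] M by (intro add_mono mult_mono) auto
    also have "\<dots> = (\<bar>E\<bar> + M + 1) * (B ^ (j + 1) * \<delta>)" by (simp add: algebra_simps)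
    also have "\<dots> \<le> B * (B ^ (j + 1) * \<delta>)" using c by (intro mult_right_mono) (simp_all add: B_def)
    finally have "cmod (w (i - 1)) \<le> B ^ (Suc j + 1) * \<delta>" by (simp add: mult.assoc)
    moreover have "cmod (w i) \<le> B ^ (Suc j + 1) * \<delta>"
      using IH(1) mult_right_mono[OF B c] by (simp add: mult.assoc)
    ultimately show ?case unfolding i by simp
  qed
  have "cmod (w n) \<le> B ^ (m + 1) * \<delta>" using propagate[of m] n by auto
  moreover have "cmod (u n) - cmod (u (int s - n)) \<le> cmod (w n)"
    using \<sigma> norm_triangle_ineq2[of "u n" "u (int s - n)"] norm_diff_ineq[of "u n" "u (int s - n)"]
    by (auto simp: w_def)
  ultimately have "(cmod (u n) - cmod (u (int s - n)))\<^sup>2 \<le> (B ^ (m + 1) * \<delta>)\<^sup>2"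
    using le by (intro power_mono) auto
  also have "\<dots> = B ^ ((m + 1) * 2) * \<delta>\<^sup>2" by (simp only: power_mult_distrib power_mult)
  also have "\<dots> \<le> B ^ (s + 2) * \<delta>\<^sup>2"
    using B by (intro mult_right_mono power_increasing) (auto simp: m_def)
  finally show ?thesis by (simp add: \<delta>(2) B_def)
qed

text \<open>
The equation is of second order and can be solved for either neighbour.
\<close>
lemma zero_of_zero_initial_data:
  assumes eq: "\<And>n. schroedinger f x u n = of_real E * u n" and 0: "u 0 = 0" "u 1 = 0"
  shows "u = (\<lambda>_. 0)"
proof -
  have fwd: "u (n + 1) = (of_real E - of_real (f (x n))) * u n - u (n - 1)" for n
    using eq[of n] by (simp add: schroedinger_def algebra_simps)
  have bwd: "u (n - 1) = (of_real E - of_real (f (x n))) * u n - u (n + 1)" for n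
    using eq[of n] by (simp add: schroedinger_def algebra_simps)
  have pos: "u (int j) = 0 \<and> u (int j + 1) = 0" for j
  proof (induction j)
    case (Suc j)
    then show ?case using fwd[of "int j + 1"] by (simp add: add.commute)
  qed (use 0 in simp)
  have neg: "u (- int j) = 0 \<and> u (- int j + 1) = 0" for j
  proof (induction j)
    case (Suc j)
    then have "u (- int j - 1) = 0" using bwd[of "- int j"] by simp
    moreover have "- int (Suc j) = - int j - 1" by simp
    ultimately show ?case using Suc by (simp only:) simp
  qed (use 0 in simp)
  have "u n = 0" for n
    using pos[of "nat n"] neg[of "nat (- n)"] by (cases "0 \<le> n") auto
  then show ?thesis by blast
qed

text \<open>
At scale \<open>N\<close> the initial values of \<open>u\<close> at \<open>0\<close> and \<open>1\<close> exceed those near \<open>s\<close> by at most a multiple of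
\<open>1 / sqrt (N + 1)\<close>, once \<open>N + 1\<close> exceeds the growth rate \<open>B\<close> of the solutions at energy \<open>E\<close>. Both terms
tend to zero.
\<close>
lemma no_eigenfunction_if_palindromic:
  assumes pal: "\<And>N. palindromic_at_scale N x" and V: "\<And>n. \<bar>f (x n)\<bar> \<le> M"
    and u: "u \<in> l2" and eq: "\<And>n. schroedinger f x u n = of_real E * u n"
  shows "u = (\<lambda>_. 0)"
proof -
  define B where "B = \<bar>E\<bar> + M + 2"
  define K where "K = 2 * (l2_norm u)\<^sup>2"
  have M: "0 \<le> M" using V[of 0] by linarith
  have K: "0 \<le> K" by (simp add: K_def)
  obtain s where s: "\<And>N. N \<le> s N" "\<And>N. reflection_symmetric x (s N) ((N + 1) ^ (s N + 3))"
    using pal unfolding palindromic_at_scale_def by metis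
  have s_top: "filterlim s at_top sequentially"
    using filterlim_ident by (rule filterlim_at_top_mono) (use s(1) in auto)
  have "u n = 0" if n: "n \<in> {0, 1}" for n
  proof -
    have far: "(\<lambda>N. cmod (u (int (s N) - n))) \<longlonglongrightarrow> 0"
    proof -
      have "(\<lambda>j. u (int j - n)) \<longlonglongrightarrow> 0" using u by (intro l2_tendsto_zero) (auto simp: inj_def)
      then have "(\<lambda>N. u (int (s N) - n)) \<longlonglongrightarrow> 0" using filterlim_compose s_top by blast
      then show ?thesis by (rule tendsto_norm_zero)
    qed
    have err: "(\<lambda>N. sqrt (K / (real N + 1))) \<longlonglongrightarrow> 0"
    proof -
      have "(\<lambda>N. sqrt (K * inverse (real (Suc N)))) \<longlonglongrightarrow> sqrt (K * 0)"
        by (intro tendsto_intros LIMSEQ_inverse_real_of_nat)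
      then show ?thesis by (simp add: divide_inverse add.commute)
    qed
    have "cmod (u n) \<le> cmod (u (int (s N) - n)) + sqrt (K / (real N + 1))" if N: "nat \<lceil>B\<rceil> \<le> N" for N
    proof (cases "cmod (u (int (s N) - n)) \<le> cmod (u n)")
      case True
      let ?L = "(N + 1) ^ (s N + 3)"
      have BN: "0 \<le> B" "B \<le> real N + 1" using N M by (auto simp: B_def) linarith
      have "s N \<le> ?L"
      proof (cases "N = 0")
        case False
        have "s N < 2 ^ s N" by (rule less_exp)
        also have "\<dots> \<le> (N + 1) ^ s N" using False by (intro power_mono) auto
        also have "\<dots> \<le> ?L" by (intro power_increasing) auto
        finally show ?thesis by simp
      next
        case True
        then show ?thesis using BN M by (simp add: B_def)
      qed
      then have "(cmod (u n) - cmod (u (int (s N) - n)))\<^sup>2 \<le> B ^ (s N + 2) * (K / (real ?L + 1))"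
        using reflected_difference_at_origin[OF u eq V s(2) _ n True] by (simp add: B_def K_def)
      also have "\<dots> \<le> (real N + 1) ^ (s N + 2) * (K / real ?L)"
      proof (intro mult_mono power_mono)
        have "0 < real ?L" by simp
        then show "K / (real ?L + 1) \<le> K / real ?L"
          using K by (intro divide_left_mono mult_pos_pos) linarith+
      qed (use BN K in auto)
      also have "\<dots> = K / (real N + 1)"
      proof -
        have "real ?L = (real N + 1) * (real N + 1) ^ (s N + 2)"
          by (simp add: numeral_3_eq_3 algebra_simps)
        moreover have "a ^ i * (K / (a * a ^ i)) = K / a" if "0 < a" for a :: real and i
          using that by simp
        ultimately show ?thesis by (simp only:)
      qed
      finally have "cmod (u n) - cmod (u (int (s N) - n)) \<le> sqrt (K / (real N + 1))"
        by (rule real_le_rsqrt)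
      then show ?thesis by simp
    qed (use K in \<open>auto intro: add_increasing2\<close>)
    then have "\<forall>\<^sub>F N in sequentially. cmod (u n) \<le> cmod (u (int (s N) - n)) + sqrt (K / (real N + 1))"
      by (rule eventually_sequentiallyI)
    then have "cmod (u n) \<le> 0 + 0"
      by (intro tendsto_lowerbound[OF tendsto_add[OF far err]]) auto
    then show ?thesis by simp
  qed
  then show ?thesis using zero_of_zero_initial_data[OF eq] by simp
qed

section \<open>Absence of point spectrum\<close>

theorem corollary6p4:
  fixes k :: nat and X :: "(int \<Rightarrow> nat) set" and f :: "nat \<Rightarrow> real"
  assumes "k \<ge> 2"
    and "AR_subshift k X"
    and "\<not> f constant_on {1..k}"
  shows "\<exists>G. gdelta_in (subshift_topology k X) G \<and>
             subshift_topology k X closure_of G = X \<and>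
             (\<forall>x\<in>G. sigma_pp (schroedinger f x) = {})"
proof (cases "X = {}")
  case True
  then show ?thesis by (intro exI[of _ "{}"]) simp
next
  case False
  then obtain y where "y \<in> X" by blast
  then interpret AR_word k y
    using AR_subshift_two_sided assms(1,2) by blast
  have X: "X = subshift"
    using AR_subshift_two_sided(2)[OF assms(1,2) \<open>y \<in> X\<close>] .
  let ?G = "{z \<in> X. \<forall>N. palindromic_at_scale N z}"
  have "sigma_pp (schroedinger f x) = {}" if x: "x \<in> ?G" for x
  proof (rule sigma_pp_empty_if_no_eigenfunction)
    have "range x \<subseteq> {1..k}" using x by (simp add: X two_sided_subshift_def)
    then have V: "\<bar>f (x n)\<bar> \<le> (\<Sum>a\<in>{1..k}. \<bar>f a\<bar>)" for n
      by (intro member_le_sum[where f = "\<lambda>a. \<bar>f a\<bar>"]) (auto simp del: atLeastAtMost_iff)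
    fix u E assume u: "u \<in> l2" and eq: "\<And>n. schroedinger f x u n = of_real E * u n"
    show "u = (\<lambda>_. 0)"
      by (rule no_eigenfunction_if_palindromic[OF _ V u eq]) (use x in blast)
  qed
  moreover have "gdelta_in (subshift_topology k X) ?G" "subshift_topology k X closure_of ?G = X"
    unfolding X by (rule generic_palindromic)+
  ultimately show ?thesis by (intro exI[of _ ?G]) blast
qed

end
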